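(* Let $k\ge 2$ be an integer and let $H=(V+s,E)$ be a graph that is $(2k,k)$-connected in $V$ and such that $d_H(s)\ge 4$ is even. There is a complete admissible splitting-off at $s$ if and only if there exists no obstacle at $s$.
   Context: All graphs are finite and undirected; loops and parallel edges are allowed. $H=(V+s,E)$ denotes a graph with vertex set $V\cup\{s\}$, where $s\notin V$ is a special vertex. $N_H(s)$ is the set of neighbors of $s$; $d_H(s)$ is the number of edges between $s$ and $V$; for $t\in V$, $d_H(s,t)$ is the number of edges between $s$ and $t$. Bi-sets. A bi-set of a ground set $\Omega$ is $\mathsf{X}=(X_O,X_I)$ with $X_I\subseteq X_O\subseteq\Omega$; $X_I$ is its inner-set, $X_O$ its outer-set, and $w(\mathsf{X})=X_O\setminus X_I$ its wall. It is trivial if $X_I=\emptyset$ or $X_O=\Omega$, and non-trivial otherwise. A bi-set with non-empty wall is called a pair. Two bi-sets $\mathsf X,\mathsf Y$ are innerly-disjoint if $X_I\cap Y_I=\emptyset$. An edge of $H$ enters $\mathsf{X}$ if one end-vertex is in $X_I$ and the other is not in $X_O$ (it may be $s$). $\hat d_H(\mathsf{X})$ is the number of edges of $H$ entering $\mathsf{X}$, and $f_H(\mathsf{X})=\hat d_H(\mathsf{X})+k|w(\mathsf{X})|$. Connectivity. $H$ is $(2k,k)$-connected in $V$ if $|V|\ge 3$ and $f_H(\mathsf{X})\ge 2k$ for every non-trivial bi-set $\mathsf{X}$ of $V$ (ground set $V$). Splitting-off. Splitting-off a pair $(su,sv)$ of distinct (possibly parallel) edges at $s$ means replacing $su,sv$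 by a new edge $uv$ (a loop if $u=v$). If $d_H(s)$ is even, a complete splitting-off at $s$ is a sequence of $\frac12 d_H(s)$ splitting-offs of disjoint pairs of edges at $s$; it is admissible if the resulting graph is $(2k,k)$-connected in $V$. Critical pairs. A non-trivial bi-set $\mathsf{X}$ of $V$ is a critical pair (in $H$) if for some pair $(su,sv)$ of edges at $s$ we have $u\in X_I$, $w(\mathsf{X})=\{v\}$ and $f_H(\mathsf{X})\le 2k$. Obstacles. For $d_H(s)$ even, $(t,\mathcal{C})$ is a $t$-star obstacle at $s$ (an obstacle, for short) if: $t$ is a neighbor of $s$ with $d_H(s,t)$ odd; $\mathcal{C}$ is a collection of critical pairs; each element of $\mathcal{C}$ has wall $\{t\}$; the elements of $\mathcal{C}$ are pairwise innerly-disjoint; and $N_H(s)\setminus\{t\}\subseteq\bigcup_{\mathsf{X}\in\mathcal{C}}X_I$. *)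

theory Defs
  imports Main "HOL-Library.Multiset" "HOL-Library.Uprod"
begin

text \<open>
  A finite undirected multigraph \<open>H = (V + s, E)\<close> is given by its vertex set \<open>V\<close>, the special
  vertex \<open>s\<close> and the multiset \<open>E\<close> of its edges. An edge is an unordered pair of end-vertices; it is
  a loop if these coincide, and multiplicities account for parallel edges.
\<close>

definition graph_with_special :: "'a set \<Rightarrow> 'a \<Rightarrow> 'a uprod multiset \<Rightarrow> bool" where
  "graph_with_special V s E \<longleftrightarrow>
     finite V \<and> s \<notin> V \<and> (\<forall>e \<in># E. set_uprod e \<subseteq> insert s V)"

text \<open>
  The edges at \<open>s\<close> are those between \<open>s\<close> and \<open>V\<close>; a possible loop at \<open>s\<close> is not among them.
\<close>

definition neighbors :: "'a set \<Rightarrow> 'a \<Rightarrow> 'a uprod multiset \<Rightarrow> 'a set" where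
  "neighbors V s E = {v \<in> V. Upair s v \<in># E}"

definition degree_at :: "'a set \<Rightarrow> 'a \<Rightarrow> 'a uprod multiset \<Rightarrow> nat" where
  "degree_at V s E = size {# e \<in># E. \<exists>v \<in> V. e = Upair s v #}"

definition edges_between :: "'a uprod multiset \<Rightarrow> 'a \<Rightarrow> 'a \<Rightarrow> nat" where
  "edges_between E s t = count E (Upair s t)"


datatype 'a biset = Biset (outer_set: "'a set") (inner_set: "'a set")

definition biset_of :: "'a set \<Rightarrow> 'a biset \<Rightarrow> bool" where
  "biset_of \<Omega> X \<longleftrightarrow> inner_set X \<subseteq> outer_set X \<and> outer_set X \<subseteq> \<Omega>"

definition wall :: "'a biset \<Rightarrow> 'a set" where
  "wall X = outer_set X - inner_set X"

definition trivial_biset :: "'a set \<Rightarrow> 'a biset \<Rightarrow> bool" where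
  "trivial_biset \<Omega> X \<longleftrightarrow> inner_set X = {} \<or> outer_set X = \<Omega>"

definition innerly_disjoint :: "'a biset \<Rightarrow> 'a biset \<Rightarrow> bool" where
  "innerly_disjoint X Y \<longleftrightarrow> inner_set X \<inter> inner_set Y = {}"

text \<open>The end-vertex outside the outer-set may be \<open>s\<close>.\<close>

definition enters :: "'a uprod \<Rightarrow> 'a biset \<Rightarrow> bool" where
  "enters e X \<longleftrightarrow> (\<exists>x y. e = Upair x y \<and> x \<in> inner_set X \<and> y \<notin> outer_set X)"

definition biset_degree :: "'a uprod multiset \<Rightarrow> 'a biset \<Rightarrow> nat" where
  "biset_degree E X = size {# e \<in># E. enters e X #}"

definition f_val :: "nat \<Rightarrow> 'a uprod multiset \<Rightarrow> 'a biset \<Rightarrow> nat" where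
  "f_val k E X = biset_degree E X + k * card (wall X)"

definition connected_2k_k :: "nat \<Rightarrow> 'a set \<Rightarrow> 'a uprod multiset \<Rightarrow> bool" where
  "connected_2k_k k V E \<longleftrightarrow>
     card V \<ge> 3 \<and>
     (\<forall>X. biset_of V X \<and> \<not> trivial_biset V X \<longrightarrow> f_val k E X \<ge> 2 * k)"


text \<open>
  The multiset inclusion makes the two edges \<open>su\<close>, \<open>sv\<close> distinct: for \<open>u = v\<close> it asks for two
  parallel edges.
\<close>

definition splitting_off ::
  "'a set \<Rightarrow> 'a \<Rightarrow> 'a uprod multiset \<Rightarrow> 'a uprod multiset \<Rightarrow> bool" where
  "splitting_off V s E E' \<longleftrightarrow>
     (\<exists>u \<in> V. \<exists>v \<in> V. {# Upair s u, Upair s v #} \<subseteq># E \<and>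
        E' = E - {# Upair s u, Upair s v #} + {# Upair u v #})"

text \<open>
  The pairs used along the sequence are automatically disjoint, since the two edges of a pair are
  removed and the new edge is not incident to \<open>s\<close>.
\<close>

definition complete_splitting_off ::
  "'a set \<Rightarrow> 'a \<Rightarrow> 'a uprod multiset \<Rightarrow> 'a uprod multiset \<Rightarrow> bool" where
  "complete_splitting_off V s E E' \<longleftrightarrow>
     even (degree_at V s E) \<and> (splitting_off V s ^^ (degree_at V s E div 2)) E E'"

definition complete_admissible_splitting_off ::
  "nat \<Rightarrow> 'a set \<Rightarrow> 'a \<Rightarrow> 'a uprod multiset \<Rightarrow> 'a uprod multiset \<Rightarrow> bool" where
  "complete_admissible_splitting_off k V s E E' \<longleftrightarrow>
     complete_splitting_off V s E E' \<and> connected_2k_k k V E'"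


text \<open>The edges \<open>su\<close>, \<open>sv\<close> below are distinct because \<open>u\<close> is in the inner-set and \<open>v\<close> in the wall.\<close>

definition critical_pair ::
  "nat \<Rightarrow> 'a set \<Rightarrow> 'a \<Rightarrow> 'a uprod multiset \<Rightarrow> 'a biset \<Rightarrow> bool" where
  "critical_pair k V s E X \<longleftrightarrow>
     biset_of V X \<and> \<not> trivial_biset V X \<and>
     (\<exists>u v. Upair s u \<in># E \<and> Upair s v \<in># E \<and>
        u \<in> inner_set X \<and> wall X = {v} \<and> f_val k E X \<le> 2 * k)"

definition star_obstacle ::
  "nat \<Rightarrow> 'a set \<Rightarrow> 'a \<Rightarrow> 'a uprod multiset \<Rightarrow> 'a \<Rightarrow> 'a biset set \<Rightarrow> bool" where
  "star_obstacle k V s E t C \<longleftrightarrow>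
     even (degree_at V s E) \<and>
     t \<in> neighbors V s E \<and> odd (edges_between E s t) \<and>
     (\<forall>X \<in> C. critical_pair k V s E X) \<and>
     (\<forall>X \<in> C. wall X = {t}) \<and>
     pairwise innerly_disjoint C \<and>
     neighbors V s E - {t} \<subseteq> (\<Union>X \<in> C. inner_set X)"

end

(*
  A pair of edges su, sv cannot be split off admissibly iff it is blocked: either u and v lie in the
  inner-set of a bi-set with f <= 2k + 1, or one of them is the wall of a tight bi-set (f = 2k)
  whose inner-set contains the other. Tight bi-sets with the same wall t can be uncrossed, so t is
  the center of an obstacle iff d(s,t) is odd and every other neighbor is covered by a tight bi-set
  with wall t; disjointness is for free.

  Existence of an admissible pair: choose t to be the wall of a critical pair with largest outer-set
  (any neighbor if there is none). If some neighbors are not covered, consider a smallest family of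
  bi-sets with f <= 2k + 1 which contain t and together contain all uncovered neighbors; uncrossing
  excludes that it has one, two, or at least three members. If all neighbors are covered, then
  d(s,t) is even, as there is no obstacle, and the pair st, st can be split off.

  If splitting off su, sv creates an obstacle with center t, then some pair at t is admissible
  instead: st, sr with r uncovered if t is not among u, v, and st, st otherwise. It makes d(s,t)
  even, so that t is no center, and the old obstacle leaves no room for one with another center.
*)
theory Submission
  imports Defs
begin

text \<open>Let X have inner-set I and wall W. Each wall vertex costs k, so two of them give f(X)
  \<ge> 2k even if X is trivial, and an edge from \<open>s\<close> to I makes this strict. Hence the
  bi-sets that matter have at most one wall vertex, and a two-element wall replaces connectivity
  where an uncrossed bi-set need not be proper. The other basic estimate comes from complementing in
  V: 2 d(s,I) + d(s,W) \<le> f(X) - 2k + d(s) for non-trivial X. If f(X) \<le> 2k + 1, then at most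
  half of the edges at \<open>s\<close> go to I, since d(s) is even. Many contradictions arise by
  gathering half of these edges in one inner-set. The bounds on blocking bi-sets reflect how much f
  loses: 2 if both ends are inner, at most 1 otherwise. The condition k \<ge> 2 is what excludes
  three members of a smallest family: they uncross to 8k + 2 \<le> 7k + 3, where one k on the right
  stems from a vertex common to all three walls.\<close>

definition sdeg :: "'a \<Rightarrow> 'a uprod multiset \<Rightarrow> 'a set \<Rightarrow> nat" where
  "sdeg s E A = size {# e \<in># E. \<exists>v \<in> A. e = Upair s v #}"

definition biset_inter :: "'a biset \<Rightarrow> 'a biset \<Rightarrow> 'a biset" where
  "biset_inter X Y = Biset (outer_set X \<inter> outer_set Y) (inner_set X \<inter> inner_set Y)"

definition biset_union :: "'a biset \<Rightarrow> 'a biset \<Rightarrow> 'a biset" where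
  "biset_union X Y = Biset (outer_set X \<union> outer_set Y) (inner_set X \<union> inner_set Y)"

text \<open>The intersection of \<open>X\<close> with the complement of \<open>Y\<close>, where
  complementing exchanges the roles of inner-set and outer-set. A wall vertex of \<open>Y\<close> in
  \<open>inner_set X\<close> therefore ends up in the wall of the difference.\<close>

definition biset_diff :: "'a biset \<Rightarrow> 'a biset \<Rightarrow> 'a biset" where
  "biset_diff X Y = Biset (outer_set X - inner_set Y) (inner_set X - outer_set Y)"

lemma biset_ops_simps [simp]:
  "outer_set (biset_inter X Y) = outer_set X \<inter> outer_set Y"
  "inner_set (biset_inter X Y) = inner_set X \<inter> inner_set Y"
  "outer_set (biset_union X Y) = outer_set X \<union> outer_set Y"
  "inner_set (biset_union X Y) = inner_set X \<union> inner_set Y"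
  "outer_set (biset_diff X Y) = outer_set X - inner_set Y"
  "inner_set (biset_diff X Y) = inner_set X - outer_set Y"
  by (auto simp: biset_inter_def biset_union_def biset_diff_def)

lemma enters_Upair:
  "enters (Upair x y) X \<longleftrightarrow>
     x \<in> inner_set X \<and> y \<notin> outer_set X \<or> y \<in> inner_set X \<and> x \<notin> outer_set X"
  by (auto simp: enters_def)

lemma s_edge_Upair:
  "(\<exists>v\<in>A. Upair x y = Upair s v) \<longleftrightarrow> x = s \<and> y \<in> A \<or> y = s \<and> x \<in> A"
  by auto

text \<open>As sums of truth values, degrees can be compared edge by edge with
  \<open>sum_mset_mono\<close>; \<open>card_eq_sum_of_bool\<close> does the same for walls, vertex
  by vertex.\<close>

lemma size_filter_mset_eq_sum:
  "size (filter_mset P M) = (\<Sum>e\<in>#M. of_bool (P e))"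
  by (induction M) auto

lemma card_eq_sum_of_bool:
  assumes "finite V" "A \<subseteq> V"
  shows "card A = (\<Sum>v\<in>V. of_bool (v \<in> A))"
proof -
  have "V \<inter> A = A" using assms by auto
  then show ?thesis using assms by simp
qed


section \<open>Uncrossing inequalities\<close>

text \<open>
  The position of a vertex relative to a bi-set is coded by two truth values, inner membership
  (lower case) and outer membership (upper case); \<open>a\<close> says that the end-vertex is \<open>s\<close>. The
  uncrossing inequalities then hold edge by edge, as finitely many cases.
\<close>

lemma submod_bool:
  "\<forall>P p. (p \<longrightarrow> P) \<longrightarrow> (\<forall>Q q. (q \<longrightarrow> Q) \<longrightarrow> (\<forall>P' p'. (p' \<longrightarrow> P') \<longrightarrow> (\<forall>Q' q'. (q' \<longrightarrow> Q') \<longrightarrow>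
     of_bool ((p \<and> q) \<and> \<not> (P' \<and> Q') \<or> (p' \<and> q') \<and> \<not> (P \<and> Q))
   + of_bool ((p \<or> q) \<and> \<not> (P' \<or> Q') \<or> (p' \<or> q') \<and> \<not> (P \<or> Q))
   \<le> of_bool (p \<and> \<not> P' \<or> p' \<and> \<not> P) + (of_bool (q \<and> \<not> Q' \<or> q' \<and> \<not> Q) :: nat))))"
  by (simp only: all_bool_eq simp_thms of_bool_eq) simp

lemma diff_bool:
  "\<forall>P p. (p \<longrightarrow> P) \<longrightarrow> (\<forall>Q q. (q \<longrightarrow> Q) \<longrightarrow> (\<forall>P' p'. (p' \<longrightarrow> P') \<longrightarrow> (\<forall>Q' q'. (q' \<longrightarrow> Q') \<longrightarrow>
   (\<forall>a. (a \<longrightarrow> \<not> P \<and> \<not> Q) \<longrightarrow> (\<forall> a'. (a' \<longrightarrow> \<not> P' \<and> \<not> Q') \<longrightarrow>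
     of_bool ((p \<and> \<not> Q) \<and> \<not> (P' \<and> \<not> q') \<or> (p' \<and> \<not> Q') \<and> \<not> (P \<and> \<not> q))
   + of_bool ((q \<and> \<not> P) \<and> \<not> (Q' \<and> \<not> p') \<or> (q' \<and> \<not> P') \<and> \<not> (Q \<and> \<not> p))
   + of_bool (a \<and> p' \<and> q' \<or> a' \<and> p \<and> q) + of_bool (a \<and> p' \<and> q' \<or> a' \<and> p \<and> q)
   + of_bool (a \<and> p' \<and> (Q' \<and> \<not> q') \<or> a' \<and> p \<and> (Q \<and> \<not> q))
   + of_bool (a \<and> (P' \<and> \<not> p') \<and> q' \<or> a' \<and> (P \<and> \<not> p) \<and> q)
   \<le> of_bool (p \<and> \<not> P' \<or> p' \<and> \<not> P) + (of_bool (q \<and> \<not> Q' \<or> q' \<and> \<not> Q) :: nat))))))"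
  by (simp only: all_bool_eq simp_thms of_bool_eq) simp

lemma three_bool:
  "\<forall>P p. (p \<longrightarrow> P) \<longrightarrow> (\<forall>Q q. (q \<longrightarrow> Q) \<longrightarrow> (\<forall>R r. (r \<longrightarrow> R) \<longrightarrow>
   (\<forall>P' p'. (p' \<longrightarrow> P') \<longrightarrow> (\<forall>Q' q'. (q' \<longrightarrow> Q') \<longrightarrow> (\<forall>R' r'. (r' \<longrightarrow> R') \<longrightarrow>
   (\<forall>a. (a \<longrightarrow> \<not> P \<and> \<not> Q \<and> \<not> R) \<longrightarrow> (\<forall> a'. (a' \<longrightarrow> \<not> P' \<and> \<not> Q' \<and> \<not> R') \<longrightarrow>
     of_bool ((p \<and> q \<and> r) \<and> \<not> (P' \<and> Q' \<and> R') \<or> (p' \<and> q' \<and> r') \<and> \<not> (P \<and> Q \<and> R))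
   + of_bool ((p \<and> \<not> (Q \<or> R)) \<and> \<not> (P' \<and> \<not> (q' \<or> r')) \<or> (p' \<and> \<not> (Q' \<or> R')) \<and> \<not> (P \<and> \<not> (q \<or> r)))
   + of_bool ((q \<and> \<not> (P \<or> R)) \<and> \<not> (Q' \<and> \<not> (p' \<or> r')) \<or> (q' \<and> \<not> (P' \<or> R')) \<and> \<not> (Q \<and> \<not> (p \<or> r)))
   + of_bool ((r \<and> \<not> (P \<or> Q)) \<and> \<not> (R' \<and> \<not> (p' \<or> q')) \<or> (r' \<and> \<not> (P' \<or> Q')) \<and> \<not> (R \<and> \<not> (p \<or> q)))
   + of_bool (a \<and> p' \<and> q' \<and> r' \<or> a' \<and> p \<and> q \<and> r) + of_bool (a \<and> p' \<and> q' \<and> r' \<or> a' \<and> p \<and> q \<and> r)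
   \<le> of_bool (p \<and> \<not> P' \<or> p' \<and> \<not> P) + of_bool (q \<and> \<not> Q' \<or> q' \<and> \<not> Q)
     + (of_bool (r \<and> \<not> R' \<or> r' \<and> \<not> R) :: nat))))))))"
  by (simp only: all_bool_eq simp_thms of_bool_eq) simp

lemma biset_degree_submod:
  fixes E :: "'a uprod multiset"
  assumes "biset_of V X" "biset_of V Y"
  shows "biset_degree E (biset_inter X Y) + biset_degree E (biset_union X Y)
       \<le> biset_degree E X + biset_degree E Y"
  unfolding biset_degree_def size_filter_mset_eq_sum sum_mset.distrib [symmetric]
proof (rule sum_mset_mono)
  fix e :: "'a uprod"
  obtain x y where e: "e = Upair x y" by (cases e)
  show "of_bool (enters e (biset_inter X Y)) + of_bool (enters e (biset_union X Y))
      \<le> of_bool (enters e X) + (of_bool (enters e Y) :: nat)"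
    unfolding e enters_Upair biset_ops_simps Int_iff Un_iff
    by (rule submod_bool [rule_format]) (use assms in \<open>auto simp: biset_of_def\<close>)
qed

text \<open>Since \<open>s\<close> lies outside both bi-sets, an edge from \<open>s\<close> to both
  inner-sets enters \<open>X\<close> and \<open>Y\<close> but neither difference, which saves 2. An
  edge from \<open>s\<close> to the inner-set of one and the wall of the other enters one bi-set and
  no difference, which saves 1.\<close>

lemma biset_degree_diff:
  fixes E :: "'a uprod multiset"
  assumes "biset_of V X" "biset_of V Y" "s \<notin> V"
  shows "biset_degree E (biset_diff X Y) + biset_degree E (biset_diff Y X)
         + sdeg s E (inner_set X \<inter> inner_set Y) + sdeg s E (inner_set X \<inter> inner_set Y)
         + sdeg s E (inner_set X \<inter> wall Y) + sdeg s E (wall X \<inter> inner_set Y)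
       \<le> biset_degree E X + biset_degree E Y"
  unfolding biset_degree_def sdeg_def size_filter_mset_eq_sum sum_mset.distrib [symmetric]
proof (rule sum_mset_mono)
  fix e :: "'a uprod"
  obtain x y where e: "e = Upair x y" by (cases e)
  show "of_bool (enters e (biset_diff X Y)) + of_bool (enters e (biset_diff Y X))
       + of_bool (\<exists>v\<in>inner_set X \<inter> inner_set Y. e = Upair s v)
       + of_bool (\<exists>v\<in>inner_set X \<inter> inner_set Y. e = Upair s v)
       + of_bool (\<exists>v\<in>inner_set X \<inter> wall Y. e = Upair s v)
       + of_bool (\<exists>v\<in>wall X \<inter> inner_set Y. e = Upair s v)
      \<le> of_bool (enters e X) + (of_bool (enters e Y) :: nat)"
    unfolding e enters_Upair biset_ops_simps s_edge_Upair wall_def Int_iff Diff_iff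
    by (rule diff_bool [rule_format]) (use assms in \<open>auto simp: biset_of_def\<close>)
qed

lemma biset_degree_three:
  fixes E :: "'a uprod multiset"
  assumes "biset_of V X" "biset_of V Y" "biset_of V Z" "s \<notin> V"
  shows "biset_degree E (biset_inter X (biset_inter Y Z)) + biset_degree E (biset_diff X (biset_union Y Z))
       + biset_degree E (biset_diff Y (biset_union X Z)) + biset_degree E (biset_diff Z (biset_union X Y))
       + sdeg s E (inner_set X \<inter> (inner_set Y \<inter> inner_set Z))
       + sdeg s E (inner_set X \<inter> (inner_set Y \<inter> inner_set Z))
       \<le> biset_degree E X + biset_degree E Y + biset_degree E Z"
  unfolding biset_degree_def sdeg_def size_filter_mset_eq_sum sum_mset.distrib [symmetric]
proof (rule sum_mset_mono)
  fix e :: "'a uprod"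
  obtain x y where e: "e = Upair x y" by (cases e)
  show "of_bool (enters e (biset_inter X (biset_inter Y Z))) + of_bool (enters e (biset_diff X (biset_union Y Z)))
       + of_bool (enters e (biset_diff Y (biset_union X Z))) + of_bool (enters e (biset_diff Z (biset_union X Y)))
       + of_bool (\<exists>v\<in>inner_set X \<inter> (inner_set Y \<inter> inner_set Z). e = Upair s v)
       + of_bool (\<exists>v\<in>inner_set X \<inter> (inner_set Y \<inter> inner_set Z). e = Upair s v)
      \<le> of_bool (enters e X) + of_bool (enters e Y) + (of_bool (enters e Z) :: nat)"
    unfolding e enters_Upair biset_ops_simps s_edge_Upair Int_iff Diff_iff Un_iff
    by (rule three_bool [rule_format]) (use assms in \<open>auto simp: biset_of_def\<close>)
qed

lemma card_wall_submod:
  assumes "biset_of V X" "biset_of V Y" "finite V"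
  shows "card (wall (biset_inter X Y)) + card (wall (biset_union X Y)) = card (wall X) + card (wall Y)"
proof -
  have sub: "wall (biset_inter X Y) \<subseteq> V" "wall (biset_union X Y) \<subseteq> V" "wall X \<subseteq> V" "wall Y \<subseteq> V"
    using assms by (auto simp: wall_def biset_of_def)
  show ?thesis
    unfolding sub [THEN card_eq_sum_of_bool [OF \<open>finite V\<close>]] sum.distrib [symmetric]
    by (rule sum.cong) (use assms in \<open>auto simp: wall_def biset_of_def\<close>)
qed

lemma card_wall_diff:
  assumes "biset_of V X" "biset_of V Y" "finite V"
  shows "card (wall (biset_diff X Y)) + card (wall (biset_diff Y X)) = card (wall X) + card (wall Y)"
proof -
  have sub: "wall (biset_diff X Y) \<subseteq> V" "wall (biset_diff Y X) \<subseteq> V" "wall X \<subseteq> V" "wall Y \<subseteq> V"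
    using assms by (auto simp: wall_def biset_of_def)
  show ?thesis
    unfolding sub [THEN card_eq_sum_of_bool [OF \<open>finite V\<close>]] sum.distrib [symmetric]
    by (rule sum.cong) (use assms in \<open>auto simp: wall_def biset_of_def\<close>)
qed

text \<open>A vertex in all three walls lies in all four walls on the left; this is the origin of
  the last term.\<close>

lemma card_wall_three:
  assumes "biset_of V X" "biset_of V Y" "biset_of V Z" "finite V"
  shows "card (wall (biset_inter X (biset_inter Y Z))) + card (wall (biset_diff X (biset_union Y Z)))
       + card (wall (biset_diff Y (biset_union X Z))) + card (wall (biset_diff Z (biset_union X Y)))
       = card (wall X) + card (wall Y) + card (wall Z) + card (wall X \<inter> wall Y \<inter> wall Z)"
proof -
  have sub: "wall (biset_inter X (biset_inter Y Z)) \<subseteq> V" "wall (biset_diff X (biset_union Y Z)) \<subseteq> V"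
    "wall (biset_diff Y (biset_union X Z)) \<subseteq> V" "wall (biset_diff Z (biset_union X Y)) \<subseteq> V"
    "wall X \<subseteq> V" "wall Y \<subseteq> V" "wall Z \<subseteq> V" "wall X \<inter> wall Y \<inter> wall Z \<subseteq> V"
    using assms by (auto simp: wall_def biset_of_def)
  show ?thesis
    unfolding sub [THEN card_eq_sum_of_bool [OF \<open>finite V\<close>]] sum.distrib [symmetric]
    by (rule sum.cong) (use assms in \<open>auto simp: wall_def biset_of_def\<close>)
qed

lemma f_val_submod:
  assumes "biset_of V X" "biset_of V Y" "finite V"
  shows "f_val k E (biset_inter X Y) + f_val k E (biset_union X Y) \<le> f_val k E X + f_val k E Y"
  using biset_degree_submod [OF assms(1,2), of E]
    arg_cong [OF card_wall_submod [OF assms], of "\<lambda>n. k * n"]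
  by (simp add: f_val_def distrib_left)

lemma f_val_diff:
  assumes "biset_of V X" "biset_of V Y" "finite V" "s \<notin> V"
  shows "f_val k E (biset_diff X Y) + f_val k E (biset_diff Y X)
         + 2 * sdeg s E (inner_set X \<inter> inner_set Y)
         + sdeg s E (inner_set X \<inter> wall Y) + sdeg s E (wall X \<inter> inner_set Y)
       \<le> f_val k E X + f_val k E Y"
  using biset_degree_diff [OF assms(1,2,4), of E]
    arg_cong [OF card_wall_diff [OF assms(1-3)], of "\<lambda>n. k * n"]
  by (simp add: f_val_def distrib_left)

text \<open>The surplus in \<open>card_wall_three\<close> costs at most \<open>k\<close> once one
  wall has at most one vertex. The factor 2 arises since an edge from \<open>s\<close> to all three
  inner-sets enters three bi-sets on the right and only one on the left.\<close>

lemma f_val_three: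
  assumes "biset_of V X" "biset_of V Y" "biset_of V Z" "finite V" "s \<notin> V" "card (wall X) \<le> 1"
  shows "f_val k E (biset_inter X (biset_inter Y Z)) + f_val k E (biset_diff X (biset_union Y Z))
       + f_val k E (biset_diff Y (biset_union X Z)) + f_val k E (biset_diff Z (biset_union X Y))
       + 2 * sdeg s E (inner_set X \<inter> (inner_set Y \<inter> inner_set Z))
       \<le> f_val k E X + f_val k E Y + f_val k E Z + k"
proof -
  have "finite (wall X)"
    using assms(1,4) by (auto simp: wall_def biset_of_def intro: finite_subset)
  then have "card (wall X \<inter> wall Y \<inter> wall Z) \<le> 1"
    by (intro order.trans [OF card_mono assms(6)]) auto
  then have "k * card (wall X \<inter> wall Y \<inter> wall Z) \<le> k"
    by (metis mult.right_neutral mult_le_mono2)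
  then show ?thesis
    using biset_degree_three [OF assms(1-3,5), of E]
      arg_cong [OF card_wall_three [OF assms(1-4)], of "\<lambda>n. k * n"]
    unfolding f_val_def distrib_left by linarith
qed


section \<open>Degrees at the special vertex\<close>

lemma sdeg_Un_disjoint:
  assumes "A \<inter> B = {}" "s \<notin> A" "s \<notin> B"
  shows "sdeg s E (A \<union> B) = sdeg s E A + sdeg s E B"
  unfolding sdeg_def size_filter_mset_eq_sum sum_mset.distrib [symmetric]
  by (rule arg_cong [where f = sum_mset], rule image_mset_cong) (use assms in auto)

lemma sdeg_mono: "A \<subseteq> B \<Longrightarrow> sdeg s E A \<le> sdeg s E B"
  unfolding sdeg_def size_filter_mset_eq_sum by (rule sum_mset_mono) auto

lemma sdeg_empty [simp]: "sdeg s E {} = 0"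
  by (simp add: sdeg_def)

lemma sdeg_singleton: "sdeg s E {t} = count E (Upair s t)"
  by (simp add: sdeg_def filter_eq_replicate_mset)

lemma sdeg_subset_union_le:
  assumes "A \<subseteq> B \<union> C" "s \<notin> B" "s \<notin> C"
  shows "sdeg s E A \<le> sdeg s E B + sdeg s E C"
proof -
  have "sdeg s E A \<le> sdeg s E (B \<union> (C - B))"
    by (rule sdeg_mono) (use assms in auto)
  also have "\<dots> = sdeg s E B + sdeg s E (C - B)"
    by (rule sdeg_Un_disjoint) (use assms in auto)
  also have "\<dots> \<le> sdeg s E B + sdeg s E C"
    by (intro add_left_mono sdeg_mono) auto
  finally show ?thesis .
qed

lemma sdeg_Un_Int:
  assumes "s \<notin> A" "s \<notin> B"
  shows "sdeg s E A + sdeg s E B = sdeg s E (A \<union> B) + sdeg s E (A \<inter> B)"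
  unfolding sdeg_def size_filter_mset_eq_sum sum_mset.distrib [symmetric]
  by (rule arg_cong [where f = sum_mset], rule image_mset_cong) (use assms in auto)

lemma degree_at_eq_sdeg: "degree_at V s E = sdeg s E V"
  by (simp add: degree_at_def sdeg_def)

lemma edges_between_eq_sdeg: "edges_between E s t = sdeg s E {t}"
  by (simp add: edges_between_def sdeg_singleton)

lemma neighbors_iff: "v \<in> neighbors V s E \<longleftrightarrow> v \<in> V \<and> 0 < sdeg s E {v}"
  by (auto simp: neighbors_def sdeg_singleton)

lemma sdeg_pos_imp_neighbor:
  assumes "0 < sdeg s E A" "A \<subseteq> V"
  shows "\<exists>v \<in> A. v \<in> neighbors V s E"
proof -
  obtain e where "e \<in># {# e \<in># E. \<exists>v \<in> A. e = Upair s v #}"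
    using assms(1) unfolding sdeg_def by (metis multiset_nonemptyE size_empty less_irrefl)
  then show ?thesis using assms(2) by (auto simp: neighbors_def)
qed

lemma sdeg_neighbors_subset:
  assumes "A \<inter> neighbors V s E \<subseteq> B" "A \<subseteq> V"
  shows "sdeg s E A \<le> sdeg s E B"
  unfolding sdeg_def size_filter_mset_eq_sum
  by (rule sum_mset_mono) (use assms in \<open>auto simp: neighbors_def\<close>)

definition proper_biset :: "'a set \<Rightarrow> 'a biset \<Rightarrow> bool" where
  "proper_biset V X \<longleftrightarrow> biset_of V X \<and> \<not> trivial_biset V X"

lemma proper_biset_iff:
  "proper_biset V X \<longleftrightarrow>
     inner_set X \<subseteq> outer_set X \<and> outer_set X \<subseteq> V \<and> inner_set X \<noteq> {} \<and> outer_set X \<noteq> V"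
  by (auto simp: proper_biset_def biset_of_def trivial_biset_def)

lemma sdeg_inner_le_biset_degree:
  assumes "biset_of V X" "s \<notin> V"
  shows "sdeg s E (inner_set X) \<le> biset_degree E X"
  unfolding biset_degree_def sdeg_def size_filter_mset_eq_sum
  by (rule sum_mset_mono) (use assms in \<open>auto simp: biset_of_def enters_Upair\<close>)

text \<open>An edge within \<open>V\<close> enters a bi-set iff it enters the complement. Only edges
  at \<open>s\<close> make a difference, because \<open>s\<close> is outside both.\<close>

lemma biset_degree_compl:
  fixes E :: "'a uprod multiset"
  assumes "biset_of V X" "graph_with_special V s E"
  shows "biset_degree E (Biset (V - inner_set X) (V - outer_set X)) + sdeg s E (inner_set X)
       = biset_degree E X + sdeg s E (V - outer_set X)"
  unfolding biset_degree_def sdeg_def size_filter_mset_eq_sum sum_mset.distrib [symmetric]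
proof (rule arg_cong [where f = sum_mset], rule image_mset_cong)
  fix e assume "e \<in># E"
  obtain x y where e: "e = Upair x y" by (cases e)
  have "x \<in> insert s V" "y \<in> insert s V" "s \<notin> V"
    using \<open>e \<in># E\<close> assms(2) unfolding e graph_with_special_def by force+
  then show "of_bool (enters e (Biset (V - inner_set X) (V - outer_set X)))
       + of_bool (\<exists>v\<in>inner_set X. e = Upair s v)
      = of_bool (enters e X) + (of_bool (\<exists>v\<in>V - outer_set X. e = Upair s v) :: nat)"
    using assms(1) unfolding e enters_Upair s_edge_Upair biset_of_def
    by (cases "x = s"; cases "y = s"; cases "x \<in> inner_set X"; cases "y \<in> inner_set X"; auto)
qed


section \<open>Tight bi-sets\<close>

locale splitting_graph =
  fixes k :: nat and V :: "'a set" and s :: 'a and E :: "'a uprod multiset"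
  assumes k_ge_2: "2 \<le> k"
    and graph: "graph_with_special V s E"
    and conn: "connected_2k_k k V E"
begin

abbreviation "f \<equiv> f_val k E"
abbreviation "d \<equiv> sdeg s E"
abbreviation "N \<equiv> neighbors V s E"

lemma finite_V: "finite V" and s_notin_V: "s \<notin> V"
  using graph by (auto simp: graph_with_special_def)

lemma proper_ge: "proper_biset V X \<Longrightarrow> 2 * k \<le> f X"
  using conn by (auto simp: connected_2k_k_def proper_biset_def)

lemma proper_imp_biset: "proper_biset V X \<Longrightarrow> biset_of V X"
  by (simp add: proper_biset_def)

lemma f_ge_walls:
  assumes "biset_of V X"
  shows "d (inner_set X) + k * card (wall X) \<le> f X"
  using sdeg_inner_le_biset_degree [OF assms s_notin_V] by (simp add: f_val_def)

lemma f_ge_two_walls: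
  assumes "biset_of V X" "{w, w'} \<subseteq> wall X" "w \<noteq> w'"
  shows "d (inner_set X) + 2 * k \<le> f X"
proof -
  have "finite (wall X)"
    using assms(1) finite_V by (auto simp: wall_def biset_of_def intro: finite_subset)
  then have "card {w, w'} \<le> card (wall X)" using assms(2) by (intro card_mono)
  then have "2 * k \<le> k * card (wall X)" using assms(3) by simp
  then show ?thesis using f_ge_walls [OF assms(1)] by linarith
qed

text \<open>The complement in \<open>V\<close> is again non-trivial and has the same wall, so
  connectivity applies to it. The outcome is an upper bound on the number of edges between
  \<open>s\<close> and the inner-set.\<close>

lemma proper_f_compl:
  assumes "proper_biset V X"
  shows "2 * d (inner_set X) + d (wall X) + 2 * k \<le> f X + d V"
proof -
  let ?Y = "Biset (V - inner_set X) (V - outer_set X)"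
  have X: "inner_set X \<subseteq> outer_set X" "outer_set X \<subseteq> V" using assms by (auto simp: proper_biset_iff)
  have "proper_biset V ?Y" using assms by (auto simp: proper_biset_iff)
  then have "2 * k \<le> f ?Y" by (rule proper_ge)
  moreover have "wall ?Y = wall X" using X by (auto simp: wall_def)
  moreover have "biset_degree E ?Y + d (inner_set X) = biset_degree E X + d (V - outer_set X)"
    using assms graph by (intro biset_degree_compl) (auto simp: proper_biset_def)
  ultimately have "2 * k + d (inner_set X) \<le> f X + d (V - outer_set X)"
    by (simp add: f_val_def)
  moreover have "d V = d (inner_set X) + d (wall X) + d (V - outer_set X)"
  proof -
    have "V = (inner_set X \<union> wall X) \<union> (V - outer_set X)" using X by (auto simp: wall_def)
    then have "d V = d ((inner_set X \<union> wall X) \<union> (V - outer_set X))" by simp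
    also have "\<dots> = d (inner_set X \<union> wall X) + d (V - outer_set X)"
      using X s_notin_V by (intro sdeg_Un_disjoint) (auto simp: wall_def)
    also have "d (inner_set X \<union> wall X) = d (inner_set X) + d (wall X)"
      using X s_notin_V by (intro sdeg_Un_disjoint) (auto simp: wall_def)
    finally show ?thesis .
  qed
  ultimately show ?thesis by linarith
qed

lemma neighbor_sdeg_pos: "v \<in> N \<Longrightarrow> v \<in> A \<Longrightarrow> 1 \<le> d A"
  using sdeg_mono [of "{v}" A s E] by (auto simp: neighbors_iff)

lemma two_neighbors_sdeg:
  assumes "u \<in> N" "v \<in> N" "u \<noteq> v" "{u, v} \<subseteq> A" 
  shows "2 \<le> d A"
proof -
  have "d ({u} \<union> {v}) = d {u} + d {v}"
    using assms s_notin_V by (intro sdeg_Un_disjoint) (auto simp: neighbors_iff)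
  moreover have "d ({u} \<union> {v}) \<le> d A" using assms by (intro sdeg_mono) auto
  ultimately show ?thesis using assms by (auto simp: neighbors_iff)
qed

lemma N_subset: "N \<subseteq> V" by (auto simp: neighbors_def)

lemma wall_cases:
  assumes "biset_of V X" "f X \<le> 2 * k + 1" "2 \<le> d (inner_set X)"
  obtains "wall X = {}" | w where "wall X = {w}" "w \<in> V"
proof (cases "wall X = {}")
  case False
  then obtain w where w: "w \<in> wall X" by auto
  have "wall X = {w}"
  proof (rule ccontr)
    assume "wall X \<noteq> {w}"
    then obtain w' where "w' \<in> wall X" "w' \<noteq> w" using w by auto
    then have "d (inner_set X) + 2 * k \<le> f X"
      using w by (intro f_ge_two_walls [OF assms(1)]) auto
    then show False using assms by linarith
  qed
  moreover have "w \<in> V" using w assms(1) by (auto simp: wall_def biset_of_def)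
  ultimately show ?thesis using that by blast
qed (use that in blast)

text \<open>By \<open>proper_ge\<close> the bound is an equality. No edges at \<open>s\<close> are
  required, unlike for critical pairs; \<open>critical_pair_iff_tight_at\<close> adds them.\<close>

definition tight_at :: "'a \<Rightarrow> 'a biset \<Rightarrow> bool" where
  "tight_at t Y \<longleftrightarrow> proper_biset V Y \<and> wall Y = {t} \<and> f Y \<le> 2 * k"

definition covered :: "'a \<Rightarrow> 'a set" where
  "covered t = {u \<in> N. \<exists>Y. tight_at t Y \<and> u \<in> inner_set Y}"

definition uncovered :: "'a \<Rightarrow> 'a set" where
  "uncovered t = N - {t} - covered t"

lemma tight_at_outer: "tight_at t Y \<Longrightarrow> outer_set Y = insert t (inner_set Y)"
  and tight_at_notin: "tight_at t Y \<Longrightarrow> t \<notin> inner_set Y"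
  by (auto simp: tight_at_def wall_def proper_biset_iff)

lemma tight_at_biset: "tight_at t Y \<Longrightarrow> biset_of V Y"
  by (auto simp: tight_at_def proper_biset_def)

text \<open>Otherwise both differences have f at least 2k: \<open>biset_diff X Y\<close> because it
  is proper, \<open>biset_diff Y X\<close> because its wall is {x, y}, whether it is proper or not.
  The edge between \<open>s\<close> and \<open>x\<close>, which saves 1, then contradicts the total
  of 4k.\<close>

lemma tight_at_imp_subset:
  assumes X: "tight_at x X" and Y: "tight_at y Y"
    and x: "x \<in> N" "x \<in> inner_set Y" and y: "y \<notin> outer_set X"
  shows "inner_set X \<subseteq> inner_set Y"
proof (rule ccontr)
  note simps = tight_at_outer [OF X] tight_at_outer [OF Y]
  note bs = tight_at_biset [OF X] tight_at_biset [OF Y]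
  assume not_sub: "\<not> inner_set X \<subseteq> inner_set Y"
  have "wall (biset_diff Y X) = {x, y}" "x \<noteq> y"
    using x y tight_at_notin [OF X] tight_at_notin [OF Y] unfolding wall_def by (auto simp: simps)
  moreover have "biset_of V (biset_diff Y X)" using bs by (auto simp: biset_of_def)
  ultimately have "2 * k \<le> f (biset_diff Y X)"
    using f_ge_two_walls [of "biset_diff Y X" x y] by auto
  moreover have "proper_biset V (biset_diff X Y)"
    using bs not_sub x y finite_V unfolding proper_biset_iff biset_of_def by (auto simp: simps)
  then have "2 * k \<le> f (biset_diff X Y)" by (rule proper_ge)
  moreover have "1 \<le> d (wall X \<inter> inner_set Y)"
    using x X by (intro neighbor_sdeg_pos [of x]) (auto simp: tight_at_def)
  moreover have "f X \<le> 2 * k" "f Y \<le> 2 * k" using X Y by (auto simp: tight_at_def)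
  ultimately show False
    using f_val_diff [OF bs finite_V s_notin_V, of k E] by linarith
qed

text \<open>Otherwise the edge between \<open>s\<close> and \<open>t\<close> brings f of
  \<open>biset_diff X Y\<close> down to 2k. This difference has \<open>t\<close> in its wall and
  \<open>r\<close> in its inner-set, so it is tight at \<open>t\<close> and covers
  \<open>r\<close>.\<close>

lemma covered_subset_outer:
  assumes t: "t \<in> N" and X: "proper_biset V X" "t \<in> inner_set X" "f X \<le> 2 * k + 1"
    and r: "r \<in> uncovered t" "r \<in> inner_set X"
    and Y: "tight_at t Y"
  shows "inner_set Y \<subseteq> outer_set X"
proof (rule ccontr)
  assume not_sub: "\<not> inner_set Y \<subseteq> outer_set X"
  note bs = proper_imp_biset [OF X(1)] tight_at_biset [OF Y]
  have rN: "r \<in> N" "r \<noteq> t" "r \<notin> inner_set Y"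
    using r Y by (auto simp: uncovered_def covered_def)
  have P: "proper_biset V (biset_diff X Y)"
    using bs not_sub rN r X unfolding proper_biset_iff biset_of_def
    by (auto simp: tight_at_outer [OF Y])
  have "proper_biset V (biset_diff Y X)"
    using bs not_sub X tight_at_notin [OF Y] unfolding proper_biset_iff biset_of_def
    by (auto simp: tight_at_outer [OF Y])
  then have "2 * k \<le> f (biset_diff Y X)" by (rule proper_ge)
  moreover have "1 \<le> d (inner_set X \<inter> wall Y)"
    using t X Y by (intro neighbor_sdeg_pos [of t]) (auto simp: tight_at_def)
  moreover have "f Y \<le> 2 * k" using Y by (simp add: tight_at_def)
  ultimately have le: "f (biset_diff X Y) \<le> 2 * k"
    using f_val_diff [OF bs finite_V s_notin_V, of k E] X(3) by linarith
  have tw: "t \<in> wall (biset_diff X Y)"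
    using X bs tight_at_notin [OF Y] by (auto simp: wall_def biset_of_def tight_at_outer [OF Y])
  have rin: "r \<in> inner_set (biset_diff X Y)"
    using r rN by (auto simp: tight_at_outer [OF Y])
  show False
  proof (cases "wall (biset_diff X Y) = {t}")
    case True
    then have "tight_at t (biset_diff X Y)" using P le by (simp add: tight_at_def)
    then show False using rin r rN by (auto simp: uncovered_def covered_def)
  next
    case False
    then obtain w where "w \<in> wall (biset_diff X Y)" "w \<noteq> t" using tw by auto
    then have "d (inner_set (biset_diff X Y)) + 2 * k \<le> f (biset_diff X Y)"
      using tw by (intro f_ge_two_walls [OF proper_imp_biset [OF P]]) auto
    moreover have "1 \<le> d (inner_set (biset_diff X Y))"
      using rin rN by (intro neighbor_sdeg_pos) auto
    ultimately show False using le by linarith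
  qed
qed

section \<open>Bi-sets with f at most 2k + 1 around a common neighbor of s\<close>

lemma wall_eq_singleton:
  assumes "biset_of V X" "f X \<le> 2 * k + 1" "2 \<le> d (inner_set X)" "w \<in> wall X"
  shows "wall X = {w}"
proof (rule wall_cases [OF assms(1-3)])
  show "wall X = {w}" if "wall X = {}" using that assms(4) by simp
  show "wall X = {w}" if "wall X = {v}" for v using that assms(4) by simp
qed

lemma card_wall_le_1:
  assumes "biset_of V X" "f X \<le> 2 * k + 1" "2 \<le> d (inner_set X)"
  shows "card (wall X) \<le> 1"
  by (rule wall_cases [OF assms]) simp_all

text \<open>The edges from \<open>s\<close> to \<open>t\<close> and \<open>w\<close> save 3, so the
  differences have total f below 4k and one of them has an empty inner-set. A wall vertex of
  \<open>X\<close> outside \<open>inner_set Y\<close> forces containment; otherwise the union is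
  proper. Its bound needs f at least 2k + 1 for the intersection, and a tight bi-set at
  \<open>w\<close> containing \<open>t\<close> is what could spoil this.\<close>

lemma merge_dangerous:
  assumes t: "t \<in> N"
    and X: "proper_biset V X" "t \<in> inner_set X" "f X \<le> 2 * k + 1"
    and Y: "proper_biset V Y" "t \<in> inner_set Y" "f Y \<le> 2 * k + 1"
    and r: "r \<in> N" "r \<noteq> t" "r \<in> inner_set Y"
    and w: "w \<in> N" "w \<in> inner_set X" "w \<in> wall Y"
    and no_tight: "\<And>Z. tight_at w Z \<Longrightarrow> t \<notin> inner_set Z"
  shows "inner_set Y \<subseteq> inner_set X \<or>
    (\<exists>U. proper_biset V U \<and> f U \<le> 2 * k + 1 \<and> inner_set U = inner_set X \<union> inner_set Y)"
proof -
  note bs = proper_imp_biset [OF X(1)] proper_imp_biset [OF Y(1)]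
  have sub: "inner_set X \<subseteq> outer_set X" "outer_set X \<subseteq> V" "inner_set Y \<subseteq> outer_set Y" "outer_set Y \<subseteq> V"
    using bs by (auto simp: biset_of_def)
  have "w \<noteq> t" using w(3) Y(2) by (auto simp: wall_def)
  have dX: "2 \<le> d (inner_set X)"
    using t w X \<open>w \<noteq> t\<close> by (intro two_neighbors_sdeg [of t w]) auto
  have dY: "2 \<le> d (inner_set Y)"
    using t r Y by (intro two_neighbors_sdeg [of t r]) auto
  have wY: "wall Y = {w}"
    by (rule wall_eq_singleton [OF bs(2) Y(3) dY w(3)])
  then have outY: "outer_set Y = insert w (inner_set Y)" "w \<notin> inner_set Y" using sub by (auto simp: wall_def)
  have "1 \<le> d (inner_set X \<inter> inner_set Y)"
    using t X Y by (intro neighbor_sdeg_pos [of t]) auto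
  moreover have "1 \<le> d (inner_set X \<inter> wall Y)"
    using w by (intro neighbor_sdeg_pos [of w]) auto
  ultimately have diff_lt: "f (biset_diff X Y) + f (biset_diff Y X) < 4 * k"
    using f_val_diff [OF bs finite_V s_notin_V, of k E] X(3) Y(3) by linarith
  have diffY: "inner_set Y \<subseteq> outer_set X \<or> 2 * k \<le> f (biset_diff Y X)"
  proof -
    have "proper_biset V (biset_diff Y X)" if "\<not> inner_set Y \<subseteq> outer_set X"
      using that sub X Y t unfolding proper_biset_iff neighbors_def by auto
    then show ?thesis using proper_ge by blast
  qed
  have diffX: "inner_set X \<subseteq> outer_set Y \<or> 2 * k \<le> f (biset_diff X Y)"
  proof -
    have "proper_biset V (biset_diff X Y)" if "\<not> inner_set X \<subseteq> outer_set Y"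
      using that sub X Y t unfolding proper_biset_iff neighbors_def by auto
    then show ?thesis using proper_ge by blast
  qed
  show ?thesis
  proof (cases "wall X \<subseteq> inner_set Y")
    case False
    then obtain v where v: "v \<in> wall X" "v \<notin> inner_set Y" by auto
    moreover have "v \<noteq> w" using v w by (auto simp: wall_def)
    ultimately have "{v, w} \<subseteq> wall (biset_diff X Y)"
      using sub w by (auto simp: wall_def outY)
    moreover have "biset_of V (biset_diff X Y)" using sub by (auto simp: biset_of_def)
    ultimately have "2 * k \<le> f (biset_diff X Y)"
      using f_ge_two_walls \<open>v \<noteq> w\<close> by fastforce
    then have "inner_set Y \<subseteq> outer_set X" using diffY diff_lt by linarith
    moreover have "wall X = {v}"
      by (rule wall_eq_singleton [OF bs(1) X(3) dX v(1)])
    ultimately have "inner_set Y \<subseteq> inner_set X" using v by (auto simp: wall_def)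
    then show ?thesis ..
  next
    case True
    let ?U = "biset_union X Y" and ?I = "biset_inter X Y"
    \<comment> \<open>As the wall of \<open>X\<close> lies in \<open>inner_set Y\<close> and
      \<open>w\<close> in \<open>inner_set X\<close>, either inclusion makes the outer-sets nested,
      so the union does not exhaust \<open>V\<close>.\<close>
    have "inner_set X \<subseteq> outer_set Y \<or> inner_set Y \<subseteq> outer_set X"
      using diffX diffY diff_lt by linarith
    then have "outer_set ?U = outer_set Y \<or> outer_set ?U = outer_set X"
      using True w sub outY unfolding wall_def by auto
    then have "proper_biset V ?U" using X Y sub unfolding proper_biset_iff by auto
    moreover have "f ?U \<le> 2 * k + 1"
    proof -
      have I: "proper_biset V ?I" using X Y sub unfolding proper_biset_iff by auto
      have "2 * k + 1 \<le> f ?I"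
      proof (cases "wall X = {}")
        case True
        then have "wall ?I = {w}" using w sub unfolding wall_def by (auto simp: outY)
        moreover have "t \<in> inner_set ?I" using X Y by auto
        ultimately have "\<not> f ?I \<le> 2 * k"
          using no_tight [of ?I] I by (auto simp: tight_at_def)
        then show ?thesis by simp
      next
        case False
        then obtain v where "v \<in> wall X" by auto
        then have "{v, w} \<subseteq> wall ?I" "v \<noteq> w"
          using w sub True unfolding wall_def by (auto simp: outY)
        then have "d (inner_set ?I) + 2 * k \<le> f ?I"
          using f_ge_two_walls [OF proper_imp_biset [OF I]] by auto
        moreover have "1 \<le> d (inner_set ?I)" using t X Y by (intro neighbor_sdeg_pos [of t]) auto
        ultimately show ?thesis by linarith
      qed
      then show ?thesis
        using f_val_submod [OF bs finite_V, of k E] X(3) Y(3) by linarith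
    qed
    ultimately show ?thesis by auto
  qed
qed

text \<open>The last hypothesis feeds \<open>merge_dangerous\<close>; securing it is the purpose of
  the later choices of \<open>t\<close>.\<close>

lemma exists_unblocked_uncovered:
  assumes t: "t \<in> N" and even: "even (d V)" and ne: "uncovered t \<noteq> {}"
    and no_tight: "\<And>r Z. r \<in> uncovered t \<Longrightarrow> tight_at r Z \<Longrightarrow> t \<notin> inner_set Z"
  shows "\<exists>r \<in> uncovered t. \<nexists>X. proper_biset V X \<and> {t, r} \<subseteq> inner_set X \<and> f X \<le> 2 * k + 1"
proof (rule ccontr)
  define dangerous where "dangerous X \<longleftrightarrow> proper_biset V X \<and> t \<in> inner_set X \<and> f X \<le> 2 * k + 1 \<and>
    inner_set X \<inter> uncovered t \<noteq> {}" for X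
  define cover where "cover F \<longleftrightarrow> finite F \<and> (\<forall>X\<in>F. dangerous X) \<and> uncovered t \<subseteq> (\<Union> (inner_set ` F))" for F
  have unc: "r \<in> N" "r \<noteq> t" if "r \<in> uncovered t" for r using that by (auto simp: uncovered_def)
  assume "\<not> ?thesis"
  then have "\<forall>r\<in>uncovered t. \<exists>X. proper_biset V X \<and> {t, r} \<subseteq> inner_set X \<and> f X \<le> 2 * k + 1" by blast
  then obtain B where B: "\<And>r. r \<in> uncovered t \<Longrightarrow>
      proper_biset V (B r) \<and> {t, r} \<subseteq> inner_set (B r) \<and> f (B r) \<le> 2 * k + 1" by metis
  have "finite (uncovered t)" using finite_subset [OF N_subset finite_V] by (simp add: uncovered_def)
  then have "cover (B ` uncovered t)" using B by (auto simp: cover_def dangerous_def)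
  then obtain F where F: "cover F" and least: "\<And>G. cover G \<Longrightarrow> card F \<le> card G"
    using ex_has_least_nat [of cover _ card] by metis
  have fin: "finite F" and dang: "\<And>X. X \<in> F \<Longrightarrow> dangerous X"
    and cov: "\<And>r. r \<in> uncovered t \<Longrightarrow> \<exists>X\<in>F. r \<in> inner_set X"
    using F by (auto simp: cover_def)
  have priv: "\<exists>r \<in> uncovered t. r \<in> inner_set X \<and> (\<forall>Y\<in>F - {X}. r \<notin> inner_set Y)" if "X \<in> F" for X
  proof (rule ccontr)
    assume "\<not> ?thesis"
    then have "cover (F - {X})" using F unfolding cover_def by blast
    then show False using least [of "F - {X}"] card_Diff1_less [OF fin that] by linarith
  qed
  \<comment> \<open>Otherwise one bi-set could replace \<open>X\<close> and \<open>Y\<close>, giving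
    a smaller family; containment is impossible because \<open>Y\<close> has a vertex of its own.
    Consequently such private vertices avoid even the outer-sets of the other members.\<close>
  have not_wall: "r \<notin> wall Y"
    if XY: "X \<in> F" "Y \<in> F" "X \<noteq> Y" and r: "r \<in> uncovered t" "r \<in> inner_set X" for X Y r
  proof
    assume rY: "r \<in> wall Y"
    obtain q where q: "q \<in> uncovered t" "q \<in> inner_set Y" "\<And>Z. Z \<in> F - {Y} \<Longrightarrow> q \<notin> inner_set Z"
      using priv [OF XY(2)] by blast
    have "\<not> inner_set Y \<subseteq> inner_set X" using q XY by auto
    then obtain U where U: "proper_biset V U" "f U \<le> 2 * k + 1" "inner_set U = inner_set X \<union> inner_set Y"
      using merge_dangerous [OF t, of X Y q r] XY(1,2) [THEN dang] q unc r rY no_tight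
      unfolding dangerous_def by blast
    have "dangerous U" using U XY(1) [THEN dang] by (auto simp: dangerous_def)
    then have "cover (insert U (F - {X, Y}))"
      using F U(3) unfolding cover_def by (auto; blast)
    then have "card F \<le> card (insert U (F - {X, Y}))" by (rule least)
    also have "\<dots> \<le> Suc (card (F - {X, Y}))" by (rule card_insert_le_m1) auto
    also have "card (F - {X, Y}) = card F - 2" using XY fin by (simp add: card_Diff_subset)
    finally have "card F \<le> 1" using card_mono [OF fin, of "{X, Y}"] XY by auto
    moreover have "card {X, Y} \<le> card F" using fin XY by (intro card_mono) auto
    ultimately show False using XY by simp
  qed
  have outside: "\<exists>r \<in> uncovered t. r \<in> inner_set X \<and> (\<forall>Y\<in>F - {X}. r \<notin> outer_set Y)" if "X \<in> F" for X
    using priv [OF that] not_wall [OF that] unfolding wall_def by (metis Diff_iff singleton_iff)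
  have cov_out: "covered t \<subseteq> outer_set X" if "X \<in> F" for X
    using dang [OF that] covered_subset_outer [OF t, of X] unfolding dangerous_def covered_def by fastforce
  have N_cases: "v = t \<or> v \<in> covered t \<or> v \<in> uncovered t" if "v \<in> N" for v
    using that by (auto simp: uncovered_def)
  have F_ne: "F \<noteq> {}" using cov ne by blast
  have compl: "2 * d (inner_set X) + d (wall X) \<le> d V + 1" if "X \<in> F" for X
    using dang [OF that] proper_f_compl [of X] unfolding dangerous_def by linarith
  have d2: "2 \<le> d (inner_set X)" if "X \<in> F" for X
    using dang [OF that] two_neighbors_sdeg [OF t] unc unfolding dangerous_def by blast
  consider X where "F = {X}" | X Y where "F = {X, Y}" "X \<noteq> Y"
    | X Y Z where "{X, Y, Z} \<subseteq> F" "X \<noteq> Y" "X \<noteq> Z" "Y \<noteq> Z"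
    using F_ne by blast
  then show False
  proof cases
    case (1 X)
    \<comment> \<open>A single member has all neighbors in its outer-set, and then
      \<open>compl\<close> allows only one edge to its inner-set, against \<open>d2\<close>.\<close>
    have "V \<inter> N \<subseteq> inner_set X \<union> wall X"
      using N_cases cov cov_out dang [of X] 1 unfolding dangerous_def wall_def by blast
    then have "d V \<le> d (inner_set X \<union> wall X)" by (rule sdeg_neighbors_subset) auto
    also have "\<dots> \<le> d (inner_set X) + d (wall X)"
      using dang [of X] 1 s_notin_V unfolding dangerous_def proper_biset_iff wall_def
      by (intro sdeg_subset_union_le) auto
    finally show False using compl [of X] d2 [of X] 1 by simp
  next
    case (2 X Y)
    then have XY: "X \<in> F" "Y \<in> F" by auto
    have pX: "proper_biset V X" "t \<in> inner_set X" "f X \<le> 2 * k + 1"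
      and pY: "proper_biset V Y" "t \<in> inner_set Y" "f Y \<le> 2 * k + 1"
      using XY [THEN dang] by (auto simp: dangerous_def)
    note bs = proper_imp_biset [OF pX(1)] proper_imp_biset [OF pY(1)]
    have sub: "inner_set X \<subseteq> outer_set X" "outer_set X \<subseteq> V" "inner_set Y \<subseteq> outer_set Y" "outer_set Y \<subseteq> V"
      using bs by (auto simp: biset_of_def)
    obtain r where r: "r \<in> uncovered t" "r \<in> inner_set X" "r \<notin> outer_set Y"
      using outside [OF XY(1)] 2 by auto
    obtain q where q: "q \<in> uncovered t" "q \<in> inner_set Y" "q \<notin> outer_set X"
      using outside [OF XY(2)] 2 by auto
    have pD: "proper_biset V (biset_diff X Y)" "proper_biset V (biset_diff Y X)"
      using pX pY r q sub unfolding proper_biset_iff by auto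
    show False
    proof (cases "N \<subseteq> inner_set X \<union> inner_set Y")
      case True
      have "d V \<le> d (inner_set X \<union> inner_set Y)"
        by (rule sdeg_neighbors_subset) (use True in auto)
      moreover have "1 \<le> d (inner_set X \<inter> inner_set Y)"
        using t pX pY by (intro neighbor_sdeg_pos [of t]) auto
      moreover have "d (inner_set X) + d (inner_set Y)
          = d (inner_set X \<union> inner_set Y) + d (inner_set X \<inter> inner_set Y)"
        using sub s_notin_V by (intro sdeg_Un_Int) auto
      \<comment> \<open>Evenness of \<open>d V\<close> removes the surplus 1 in
        \<open>compl\<close>. The two halves overlap in \<open>t\<close>, so they cannot cover all
        edges.\<close>
      moreover have "2 * d (inner_set X) \<le> d V" "2 * d (inner_set Y) \<le> d V"
        using XY [THEN compl] even by (auto elim!: evenE)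
      ultimately show False by linarith
    next
      case False
      then obtain w where w: "w \<in> N" "w \<notin> inner_set X" "w \<notin> inner_set Y" by auto
      then have "w \<in> covered t" using N_cases [OF w(1)] pX cov [of w] 2 by auto
      then have wXY: "w \<in> wall X" "w \<in> wall Y"
        using XY [THEN cov_out] w by (auto simp: wall_def)
      obtain Z where Z: "tight_at t Z" "w \<in> inner_set Z" using \<open>w \<in> covered t\<close> by (auto simp: covered_def)
      have walls: "wall X = {w}" "wall Y = {w}"
        using wall_eq_singleton [OF bs(1) pX(3) d2 [OF XY(1)] wXY(1)]
          wall_eq_singleton [OF bs(2) pY(3) d2 [OF XY(2)] wXY(2)] .
      have "1 \<le> d (inner_set X \<inter> inner_set Y)"
        using t pX pY by (intro neighbor_sdeg_pos [of t]) auto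
      \<comment> \<open>Both walls are {w}, so the saving of 2 at \<open>t\<close> makes the
        difference tight at \<open>w\<close>. As it misses \<open>t\<close>,
        \<open>tight_at_imp_subset\<close> puts its inner-set, and with it \<open>r\<close>, into
        \<open>Z\<close>.\<close>
      then have "f (biset_diff X Y) \<le> 2 * k"
        using f_val_diff [OF bs finite_V s_notin_V, of k E] pX(3) pY(3) proper_ge [OF pD(2)] by linarith
      moreover have "wall (biset_diff X Y) = {w}"
        using walls sub unfolding wall_def by auto
      ultimately have P: "tight_at w (biset_diff X Y)" using pD by (simp add: tight_at_def)
      have "inner_set (biset_diff X Y) \<subseteq> inner_set Z"
        by (rule tight_at_imp_subset [OF P Z(1) w(1) Z(2)]) (use pY in auto)
      then have "r \<in> inner_set Z" using r by auto
      then show False using r Z by (auto simp: uncovered_def covered_def)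
    qed
  next
    case (3 X Y Z)
    then have XYZ: "X \<in> F" "Y \<in> F" "Z \<in> F" by auto
    have p: "proper_biset V A" "t \<in> inner_set A" "f A \<le> 2 * k + 1" if "A \<in> F" for A
      using dang [OF that] by (auto simp: dangerous_def)
    note bs = XYZ [THEN p(1), THEN proper_imp_biset]
    have sub: "inner_set X \<subseteq> outer_set X" "outer_set X \<subseteq> V" "inner_set Y \<subseteq> outer_set Y" "outer_set Y \<subseteq> V"
      "inner_set Z \<subseteq> outer_set Z" "outer_set Z \<subseteq> V"
      using bs by (auto simp: biset_of_def)
    have "card (wall X) \<le> 1"
      by (rule card_wall_le_1 [OF bs(1) p(3) d2, OF XYZ(1) XYZ(1)])
    note three = f_val_three [OF bs finite_V s_notin_V this, of k E]
    have "2 * k \<le> f (biset_inter X (biset_inter Y Z))"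
      using sub XYZ [THEN p(1)] XYZ [THEN p(2)] by (intro proper_ge) (auto simp: proper_biset_iff)
    moreover have "2 * k \<le> f (biset_diff X (biset_union Y Z))"
      using outside [OF XYZ(1)] sub XYZ [THEN p(1)] 3 XYZ by (intro proper_ge) (auto simp: proper_biset_iff)
    moreover have "2 * k \<le> f (biset_diff Y (biset_union X Z))"
      using outside [OF XYZ(2)] sub XYZ [THEN p(1)] 3 XYZ by (intro proper_ge) (auto simp: proper_biset_iff)
    moreover have "2 * k \<le> f (biset_diff Z (biset_union X Y))"
      using outside [OF XYZ(3)] sub XYZ [THEN p(1)] 3 XYZ by (intro proper_ge) (auto simp: proper_biset_iff)
    moreover have "1 \<le> d (inner_set X \<inter> (inner_set Y \<inter> inner_set Z))"
      using t XYZ [THEN p(2)] by (intro neighbor_sdeg_pos [of t]) auto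
    \<comment> \<open>Four proper bi-sets and a saving of 2 give 8k + 2 \<le> 3(2k + 1) + k, which
      is impossible for k \<ge> 2.\<close>
    ultimately show False using three XYZ [THEN p(3)] k_ge_2 by linarith
  qed
qed

end

section \<open>Splitting-off and blocking bi-sets\<close>

definition split_at :: "'a \<Rightarrow> 'a \<Rightarrow> 'a \<Rightarrow> 'a uprod multiset \<Rightarrow> 'a uprod multiset" where
  "split_at s u v E = E - {# Upair s u, Upair s v #} + {# Upair u v #}"

text \<open>Losses are added on the left, as subtraction of naturals truncates.\<close>

lemma biset_degree_split_at:
  assumes "biset_of V X" "s \<notin> V" "{# Upair s u, Upair s v #} \<subseteq># E"
  shows "biset_degree (split_at s u v E) X + of_bool (u \<in> inner_set X) + of_bool (v \<in> inner_set X)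
       = biset_degree E X + of_bool (enters (Upair u v) X)"
proof -
  obtain E0 where E: "E = {# Upair s u, Upair s v #} + E0" using assms(3) by (metis mset_subset_eq_exists_conv)
  have "enters (Upair s w) X \<longleftrightarrow> w \<in> inner_set X" for w
    using assms by (auto simp: enters_Upair biset_of_def)
  then show ?thesis by (simp add: E split_at_def biset_degree_def)
qed

lemma f_val_split_at:
  assumes "biset_of V X" "s \<notin> V" "{# Upair s u, Upair s v #} \<subseteq># E"
  shows "f_val k (split_at s u v E) X + of_bool (u \<in> inner_set X) + of_bool (v \<in> inner_set X)
       = f_val k E X + of_bool (enters (Upair u v) X)"
  using biset_degree_split_at [OF assms] by (simp add: f_val_def)

lemma sdeg_split_at:
  assumes "A \<subseteq> V" "s \<notin> V" "u \<in> V" "v \<in> V" "{# Upair s u, Upair s v #} \<subseteq># E"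
  shows "sdeg s (split_at s u v E) A + of_bool (u \<in> A) + of_bool (v \<in> A) = sdeg s E A"
proof -
  obtain E0 where E: "E = {# Upair s u, Upair s v #} + E0" using assms(5) by (metis mset_subset_eq_exists_conv)
  have "s \<notin> A" "u \<noteq> s" "v \<noteq> s" using assms by auto
  then show ?thesis by (simp add: E split_at_def sdeg_def s_edge_Upair del: Upair_inject)
qed

lemma graph_with_special_split_at:
  assumes "graph_with_special V s E" "u \<in> V" "v \<in> V"
  shows "graph_with_special V s (split_at s u v E)"
  using assms by (auto simp: graph_with_special_def split_at_def dest: in_diffD)

lemma splitting_off_iff:
  "splitting_off V s E E' \<longleftrightarrow>
     (\<exists>u\<in>V. \<exists>v\<in>V. {# Upair s u, Upair s v #} \<subseteq># E \<and> E' = split_at s u v E)"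
  by (simp add: splitting_off_def split_at_def)

lemma split_at_commute: "split_at s u v E = split_at s v u E"
  by (simp add: split_at_def add_mset_commute Upair_inject)

lemma pair_subset_mset_iff:
  "{# Upair s u, Upair s v #} \<subseteq># E \<longleftrightarrow>
     0 < sdeg s E {u} \<and> 0 < sdeg s E {v} \<and> (u = v \<longrightarrow> 2 \<le> sdeg s E {u})"
proof -
  have "{# Upair s u, Upair s v #} \<subseteq># E \<longleftrightarrow>
    Upair s u \<in># E \<and> Upair s v \<in># E - {# Upair s u #}"
    by (simp add: insert_subset_eq_iff)
  then show ?thesis
    by (cases "u = v") (auto simp: sdeg_singleton in_diff_count Suc_le_eq)
qed

text \<open>
  Here \<open>p\<close>, \<open>q\<close> stand for membership in two disjoint sets, and \<open>r\<close> for being their common wall,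
  which is the inner-set of a third bi-set with outer-set \<open>R\<close>.
\<close>

lemma singleton_inner_bool:
  "\<forall>p q r R. (p \<longrightarrow> \<not> q) \<longrightarrow> (r \<longrightarrow> R) \<longrightarrow> (R \<longrightarrow> \<not> p \<and> \<not> q) \<longrightarrow>
   (\<forall>p' q' r' R'. (p' \<longrightarrow> \<not> q') \<longrightarrow> (r' \<longrightarrow> R') \<longrightarrow> (R' \<longrightarrow> \<not> p' \<and> \<not> q') \<longrightarrow>
   (\<forall>a. (a \<longrightarrow> \<not> p \<and> \<not> q \<and> \<not> R) \<longrightarrow> (\<forall>a'. (a' \<longrightarrow> \<not> p' \<and> \<not> q' \<and> \<not> R') \<longrightarrow>
     of_bool (p \<and> \<not> p' \<or> p' \<and> \<not> p) + of_bool (q \<and> \<not> q' \<or> q' \<and> \<not> q) + of_bool (a \<and> r' \<or> a' \<and> r)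
   \<le> of_bool (r \<and> \<not> R' \<or> r' \<and> \<not> R) + of_bool (p \<and> \<not> (r' \<or> p') \<or> p' \<and> \<not> (r \<or> p))
     + (of_bool (q \<and> \<not> (r' \<or> q') \<or> q' \<and> \<not> (r \<or> q)) :: nat))))"
  by (simp only: all_bool_eq simp_thms of_bool_eq) simp

context splitting_graph begin

text \<open>A bi-set that falls below 2k has lost 2, or it has lost 1 and is not entered by the new
  edge. In the latter case one end is inner and the other lies in the wall, and a second wall vertex
  is excluded by the edge from \<open>s\<close> to the inner end.\<close>

lemma not_connected_split_at:
  assumes uv: "u \<in> V" "v \<in> V" "{# Upair s u, Upair s v #} \<subseteq># E"
    and not_conn: "\<not> connected_2k_k k V (split_at s u v E)"
  shows "(\<exists>X. proper_biset V X \<and> {u, v} \<subseteq> inner_set X \<and> f X \<le> 2 * k + 1) \<or>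
    (\<exists>X. tight_at v X \<and> u \<in> inner_set X) \<or> (\<exists>X. tight_at u X \<and> v \<in> inner_set X)"
proof -
  obtain X where X: "proper_biset V X" "f_val k (split_at s u v E) X < 2 * k"
    using conn not_conn by (auto simp: connected_2k_k_def proper_biset_def not_le)
  note bs = proper_imp_biset [OF X(1)]
  note eq = f_val_split_at [OF bs s_notin_V uv(3), of k]
  have N: "u \<in> N" "v \<in> N" using uv by (auto simp: pair_subset_mset_iff neighbors_iff)
  have tight: "tight_at y X"
    if "x \<in> inner_set X" "y \<notin> inner_set X" "x \<in> N" "f X \<le> 2 * k" "y \<in> outer_set X" for x y
  proof -
    have "wall X = {y}"
    proof (rule ccontr)
      assume "wall X \<noteq> {y}"
      moreover have "y \<in> wall X" using that by (auto simp: wall_def)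
      ultimately obtain w where "w \<in> wall X" "w \<noteq> y" by auto
      then have "d (inner_set X) + 2 * k \<le> f X"
        using \<open>y \<in> wall X\<close> by (intro f_ge_two_walls [OF bs, of w y]) auto
      moreover have "1 \<le> d (inner_set X)" using that by (intro neighbor_sdeg_pos [of x]) auto
      ultimately show False using that by linarith
    qed
    then show ?thesis using X that by (simp add: tight_at_def)
  qed
  have ge: "2 * k \<le> f X" by (rule proper_ge [OF X(1)])
  consider "u \<in> inner_set X" "v \<in> inner_set X" | "u \<in> inner_set X" "v \<notin> inner_set X"
    | "u \<notin> inner_set X" "v \<in> inner_set X" | "u \<notin> inner_set X" "v \<notin> inner_set X" by blast
  then show ?thesis
  proof cases
    case 1
    then have "f X \<le> 2 * k + 1" using eq X(2) by (simp split: if_splits)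
    then show ?thesis using 1 X by blast
  next
    case 2
    then have "\<not> enters (Upair u v) X" using eq X(2) ge by (auto simp: of_bool_def split: if_splits)
    then have "v \<in> outer_set X" "f X \<le> 2 * k"
      using 2 eq X(2) by (auto simp: enters_Upair)
    then show ?thesis using tight [of u v] 2 N by blast
  next
    case 3
    then have "\<not> enters (Upair u v) X" using eq X(2) ge by (auto simp: of_bool_def split: if_splits)
    then have "u \<in> outer_set X" "f X \<le> 2 * k"
      using 3 eq X(2) by (auto simp: enters_Upair)
    then show ?thesis using tight [of v u] 3 N by blast
  next
    case 4
    then show ?thesis using eq X(2) ge by simp
  qed
qed

text \<open>Of the three ways to block the pair, tight bi-sets at \<open>t\<close> are excluded by
  \<open>r\<close> being uncovered, those at \<open>r\<close> by the last hypothesis, and the third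
  by \<open>exists_unblocked_uncovered\<close>.\<close>

lemma admissible_uncovered:
  assumes t: "t \<in> N" and even: "even (d V)" and ne: "uncovered t \<noteq> {}"
    and no_tight: "\<And>r Z. r \<in> uncovered t \<Longrightarrow> tight_at r Z \<Longrightarrow> t \<notin> inner_set Z"
  shows "\<exists>r \<in> uncovered t. connected_2k_k k V (split_at s t r E)"
proof -
  obtain r where r: "r \<in> uncovered t"
    and nX: "\<not> (\<exists>X. proper_biset V X \<and> {t, r} \<subseteq> inner_set X \<and> f X \<le> 2 * k + 1)"
    using exists_unblocked_uncovered [OF t even ne no_tight] by (rule bexE)
  have rN: "r \<in> N" "r \<noteq> t" "\<And>X. tight_at t X \<Longrightarrow> r \<notin> inner_set X"
    using r by (auto simp: uncovered_def covered_def)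
  have sub: "{# Upair s t, Upair s r #} \<subseteq># E"
    using t rN by (auto simp: pair_subset_mset_iff neighbors_iff)
  have "connected_2k_k k V (split_at s t r E)"
  proof (rule ccontr)
    assume "\<not> ?thesis"
    moreover have "t \<in> V" "r \<in> V" using t rN(1) N_subset by (simp_all add: subset_iff)
    ultimately have "(\<exists>X. tight_at r X \<and> t \<in> inner_set X) \<or> (\<exists>X. tight_at t X \<and> r \<in> inner_set X)"
      using not_connected_split_at [OF _ _ sub] nX by argo
    then show False
    proof (elim disjE exE conjE)
      show False if "tight_at r X" "t \<in> inner_set X" for X using no_tight [OF r that(1)] that(2) ..
      show False if "tight_at t X" "r \<in> inner_set X" for X using rN(3) [OF that(1)] that(2) ..
    qed
  qed
  then show ?thesis using r by blast
qed

text \<open>A tight bi-set at an uncovered \<open>r\<close> with \<open>t\<close> in its inner-set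
  would swallow, by \<open>tight_at_imp_subset\<close>, the inner-sets of all tight bi-sets at
  \<open>t\<close>. It would hold at least half of the edges at \<open>s\<close>, while
  complementing leaves it less than half.\<close>

lemma admissible_uncovered_if_large:
  assumes t: "t \<in> N" and even: "even (d V)" and ne: "uncovered t \<noteq> {}"
    and large: "d V \<le> 2 * (d (covered t) + d {t})"
  shows "\<exists>r \<in> uncovered t. connected_2k_k k V (split_at s t r E)"
proof -
  have "t \<notin> inner_set Z" if r: "r \<in> uncovered t" and Z: "tight_at r Z" for r Z
  proof
    assume tZ: "t \<in> inner_set Z"
    have rN: "r \<in> N" "r \<noteq> t" using r by (auto simp: uncovered_def)
    have "covered t \<subseteq> inner_set Z"
    proof
      fix u assume "u \<in> covered t"
      then obtain Y where Y: "tight_at t Y" "u \<in> inner_set Y" by (auto simp: covered_def)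
      then have "r \<notin> inner_set Y" using r by (auto simp: uncovered_def covered_def)
      then have "inner_set Y \<subseteq> inner_set Z"
        using rN by (intro tight_at_imp_subset [OF Y(1) Z t tZ]) (simp add: tight_at_outer [OF Y(1)])
      then show "u \<in> inner_set Z" using Y by blast
    qed
    moreover have "covered t \<inter> {t} = {}" "s \<notin> covered t" "s \<notin> {t}"
      using t N_subset s_notin_V tight_at_notin unfolding covered_def by blast+
    then have "d (covered t \<union> {t}) = d (covered t) + d {t}"
      by (rule sdeg_Un_disjoint)
    ultimately have "d (covered t) + d {t} \<le> d (inner_set Z)"
      using tZ sdeg_mono [of "covered t \<union> {t}" "inner_set Z" s E] by simp
    moreover have "2 * d (inner_set Z) + d {r} \<le> d V"
      using proper_f_compl [of Z] Z by (simp add: tight_at_def)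
    ultimately show False using large rN by (simp add: neighbors_iff)
  qed
  then show ?thesis by (rule admissible_uncovered [OF t even ne])
qed

section \<open>Splitting off two parallel edges at a center\<close>

lemma tight_at_sdeg_le:
  assumes "tight_at t Y"
  shows "2 * d (inner_set Y) + d {t} \<le> d V"
proof -
  have "proper_biset V Y" "wall Y = {t}" "f Y \<le> 2 * k" using assms by (auto simp: tight_at_def)
  then show ?thesis using proper_f_compl [of Y] by simp
qed

text \<open>With empty wall, \<open>inner_set A\<close> has degree at least 2k, whereas
  \<open>A\<close> has degree at most k; so at least k edges join \<open>t\<close> to
  \<open>inner_set A\<close>, and likewise for \<open>B\<close>. All of them, and the edges from
  \<open>t\<close> to \<open>s\<close>, enter \<open>X\<close>.\<close>

lemma singleton_inner_lower_bound:
  assumes X: "biset_of V X" "inner_set X = {t}" and AB: "tight_at t A" "tight_at t B"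
    and disj: "inner_set A \<inter> inner_set B = {}" "wall X \<inter> inner_set A = {}" "wall X \<inter> inner_set B = {}"
  shows "2 * k + d {t} \<le> f X"
proof -
  let ?A = "Biset (inner_set A) (inner_set A)" and ?B = "Biset (inner_set B) (inner_set B)"
  have t: "t \<notin> inner_set A" "t \<notin> inner_set B" using AB by (simp_all add: tight_at_notin)
  have tV: "t \<in> V" using X by (auto simp: biset_of_def)
  have tX: "t \<in> outer_set X" using X by (auto simp: biset_of_def)
  have sub: "inner_set A \<subseteq> V" "inner_set B \<subseteq> V" "outer_set X \<subseteq> V"
    using AB X by (auto simp: tight_at_def proper_biset_iff biset_of_def)
  have oX: "outer_set X \<inter> inner_set A = {}" "outer_set X \<inter> inner_set B = {}"
    using X disj t by (auto simp: wall_def)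
  have proper: "proper_biset V ?A" "proper_biset V ?B"
    using AB t tV by (auto simp: tight_at_def proper_biset_iff)
  have "biset_degree E ?A + biset_degree E ?B + d {t}
      \<le> biset_degree E X + biset_degree E A + biset_degree E B"
    unfolding biset_degree_def sdeg_def size_filter_mset_eq_sum sum_mset.distrib [symmetric]
  proof (rule sum_mset_mono)
    fix e :: "'a uprod"
    obtain x y where e: "e = Upair x y" by (cases e)
    show "of_bool (enters e ?A) + of_bool (enters e ?B) + of_bool (\<exists>v\<in>{t}. e = Upair s v)
        \<le> of_bool (enters e X) + of_bool (enters e A) + (of_bool (enters e B) :: nat)"
      unfolding e enters_Upair s_edge_Upair tight_at_outer [OF AB(1)] tight_at_outer [OF AB(2)] X(2)
        biset.sel insert_iff empty_iff simp_thms
      by (rule singleton_inner_bool [rule_format]) (use t tV tX sub oX disj(1) s_notin_V in auto)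
  qed
  moreover have "2 * k \<le> biset_degree E ?A" "2 * k \<le> biset_degree E ?B"
    using proper [THEN proper_ge] by (simp_all add: f_val_def wall_def)
  moreover have "biset_degree E A \<le> k" "biset_degree E B \<le> k"
    using AB by (auto simp: tight_at_def f_val_def)
  ultimately show ?thesis by (simp add: f_val_def)
qed

text \<open>A blocking bi-set can be chosen so that, apart from \<open>t\<close>, it contains or is
  contained in each member. If it contains all of them, it has more than half of the edges at
  \<open>s\<close>. Otherwise it lies, up to \<open>t\<close>, in two disjoint members, so its
  inner-set is {t} and \<open>singleton_inner_lower_bound\<close> applies.\<close>

lemma admissible_center_pair:
  assumes t: "t \<in> N" "2 \<le> d {t}" and even: "even (d V)"
    and tight: "\<And>Y. Y \<in> C \<Longrightarrow> tight_at t Y" and disj: "pairwise innerly_disjoint C"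
    and AB: "A \<in> C" "B \<in> C" "A \<noteq> B"
    and large: "d V < 2 * (d (\<Union> (inner_set ` C)) + d {t})"
  shows "connected_2k_k k V (split_at s t t E)"
proof (rule ccontr)
  have tV: "t \<in> V" using t N_subset by auto
  have disjoint: "inner_set Y \<inter> inner_set Z = {}" if "Y \<in> C" "Z \<in> C" "Y \<noteq> Z" for Y Z
    using disj that by (auto simp: pairwise_def innerly_disjoint_def)
  have nonempty: "inner_set Y \<noteq> {}" if "Y \<in> C" for Y
    using tight [OF that] by (auto simp: tight_at_def proper_biset_iff)
  assume "\<not> ?thesis"
  moreover have "{# Upair s t, Upair s t #} \<subseteq># E" using t by (auto simp: pair_subset_mset_iff)
  ultimately obtain X0 where X0: "proper_biset V X0" "t \<in> inner_set X0" "f X0 \<le> 2 * k + 1"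
    using not_connected_split_at [OF tV tV] tight_at_notin by blast
  \<comment> \<open>The edges between \<open>s\<close> and \<open>t\<close> end in the wall of
    \<open>Y\<close>; being at least two, they save more than the surplus 1 of
    \<open>X\<close>.\<close>
  have dich: "inner_set X - {t} \<subseteq> inner_set Y \<or> inner_set Y \<subseteq> outer_set X"
    if X: "proper_biset V X" "t \<in> inner_set X" "f X \<le> 2 * k + 1" and Y: "Y \<in> C" for X Y
  proof (rule ccontr)
    note T = tight [OF Y]
    note bs = proper_imp_biset [OF X(1)] tight_at_biset [OF T]
    assume "\<not> ?thesis"
    then have "proper_biset V (biset_diff X Y)" "proper_biset V (biset_diff Y X)"
      using bs X tV nonempty [OF Y] unfolding proper_biset_iff biset_of_def tight_at_outer [OF T]
      by (auto simp: tight_at_outer [OF T])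
    then have "2 * k \<le> f (biset_diff X Y)" "2 * k \<le> f (biset_diff Y X)" by (auto intro: proper_ge)
    moreover have "d {t} \<le> d (inner_set X \<inter> wall Y)"
      using X T by (intro sdeg_mono) (auto simp: tight_at_def)
    moreover have "f Y \<le> 2 * k" using T by (simp add: tight_at_def)
    ultimately show False
      using f_val_diff [OF bs finite_V s_notin_V, of k E] X(3) t(2) by linarith
  qed
  \<comment> \<open>If the wall {w} of \<open>X0\<close> meets a member \<open>Y\<close>, the union
    with \<open>Y\<close> has empty wall: \<open>t\<close> is inner in \<open>X0\<close> and
    \<open>w\<close> is inner in \<open>Y\<close>. The intersection has both \<open>t\<close> and
    \<open>w\<close> in its wall, so the union keeps the bound 2k + 1.\<close>
  obtain X where X: "proper_biset V X" "t \<in> inner_set X" "f X \<le> 2 * k + 1"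
    and wX: "\<And>Y. Y \<in> C \<Longrightarrow> wall X \<inter> inner_set Y = {}"
  proof (cases "\<exists>Y\<in>C. wall X0 \<inter> inner_set Y \<noteq> {}")
    case False
    then show ?thesis using that X0 by blast
  next
    case True
    then obtain Y w where Y: "Y \<in> C" "w \<in> wall X0" "w \<in> inner_set Y" by auto
    note T = tight [OF Y(1)]
    note bs = proper_imp_biset [OF X0(1)] tight_at_biset [OF T]
    have sub: "inner_set X0 \<subseteq> outer_set X0" "outer_set X0 \<subseteq> V" "inner_set Y \<subseteq> V"
      using bs by (auto simp: biset_of_def)
    let ?U = "biset_union X0 Y" and ?I = "biset_inter X0 Y"
    have "d {t} \<le> d (inner_set X0)" using X0 by (intro sdeg_mono) auto
    then have "wall X0 = {w}"
      using t(2) by (intro wall_eq_singleton [OF bs(1) X0(3) _ Y(2)]) linarith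
    then have out: "outer_set X0 = insert w (inner_set X0)" using sub by (auto simp: wall_def)
    have U: "wall ?U = {}" using Y X0 unfolding wall_def by (auto simp: out tight_at_outer [OF T])
    have "outer_set ?U = outer_set Y \<or> outer_set ?U = outer_set X0"
      using dich [OF X0 Y(1)] Y X0 by (auto simp: out tight_at_outer [OF T])
    then have pU: "proper_biset V ?U"
      using X0 T bs unfolding proper_biset_iff tight_at_def biset_of_def by auto
    have "{t, w} \<subseteq> wall ?I" "t \<noteq> w"
      using Y X0 tight_at_notin [OF T] sub by (auto simp: wall_def tight_at_outer [OF T])
    moreover have "biset_of V ?I" using bs by (auto simp: biset_of_def)
    ultimately have "2 * k \<le> f ?I" using f_ge_two_walls [of ?I t w] by linarith
    moreover have "f Y \<le> 2 * k" using T by (simp add: tight_at_def)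
    ultimately have "f ?U \<le> 2 * k + 1"
      using f_val_submod [OF bs finite_V, of k E] X0(3) by linarith
    then show ?thesis using that [of ?U] pU U X0 by simp
  qed
  have dich': "inner_set X - {t} \<subseteq> inner_set Y \<or> inner_set Y \<subseteq> inner_set X" if "Y \<in> C" for Y
    using dich [OF X that] wX [OF that] by (auto simp: wall_def)
  show False
  proof (cases "\<forall>Y\<in>C. inner_set Y \<subseteq> inner_set X")
    case True
    have "d ((\<Union> (inner_set ` C)) \<union> {t}) = d (\<Union> (inner_set ` C)) + d {t}"
      using tight tight_at_notin s_notin_V tV by (intro sdeg_Un_disjoint)
        (auto simp: tight_at_def proper_biset_iff)
    moreover have "d ((\<Union> (inner_set ` C)) \<union> {t}) \<le> d (inner_set X)"
      using True X by (intro sdeg_mono) auto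
    moreover have "2 * d (inner_set X) \<le> d V + 1"
      using proper_f_compl [OF X(1)] X(3) by linarith
    then have "2 * d (inner_set X) \<le> d V" using even by (auto elim!: evenE)
    ultimately show False using large by simp
  next
    case False
    then obtain Y where Y: "Y \<in> C" "\<not> inner_set Y \<subseteq> inner_set X" by auto
    obtain Z where Z: "Z \<in> C" "Z \<noteq> Y" using AB by metis
    have XY: "inner_set X - {t} \<subseteq> inner_set Y" using dich' [OF Y(1)] Y by auto
    have "\<not> inner_set Z \<subseteq> inner_set X"
      using XY disjoint [OF Z(1) Y(1) Z(2)] nonempty [OF Z(1)] tight_at_notin [OF tight [OF Z(1)]] by blast
    then have "inner_set X - {t} \<subseteq> inner_set Z" using dich' [OF Z(1)] by auto
    then have "inner_set X = {t}" using XY disjoint [OF Z(1) Y(1) Z(2)] X(2) by blast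
    then have "2 * k + d {t} \<le> f X"
      using disjoint [OF Z(1) Y(1) Z(2)] wX Y Z
      by (intro singleton_inner_lower_bound [OF proper_imp_biset [OF X(1)], of t Z Y] tight) auto
    then show False using X(3) t(2) by linarith
  qed
qed

end

section \<open>Obstacles\<close>

context splitting_graph begin

lemma critical_pair_iff_tight_at:
  "critical_pair k V s E X \<and> wall X = {t} \<longleftrightarrow> t \<in> N \<and> tight_at t X \<and> inner_set X \<inter> N \<noteq> {}"
proof
  assume "critical_pair k V s E X \<and> wall X = {t}"
  then obtain u where "Upair s u \<in># E" "Upair s t \<in># E" "u \<in> inner_set X" "f X \<le> 2 * k"
    "proper_biset V X" "wall X = {t}"
    by (auto simp: critical_pair_def proper_biset_def)
  moreover from this have "u \<in> V" "t \<in> V" by (auto simp: proper_biset_iff wall_def)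
  ultimately show "t \<in> N \<and> tight_at t X \<and> inner_set X \<inter> N \<noteq> {}"
    by (auto simp: neighbors_def tight_at_def)
next
  assume "t \<in> N \<and> tight_at t X \<and> inner_set X \<inter> N \<noteq> {}"
  then show "critical_pair k V s E X \<and> wall X = {t}"
    by (auto simp: critical_pair_def neighbors_def tight_at_def proper_biset_def)
qed

lemma star_obstacle_iff:
  "star_obstacle k V s E t C \<longleftrightarrow>
     even (d V) \<and> t \<in> N \<and> odd (d {t}) \<and> (\<forall>X\<in>C. tight_at t X \<and> inner_set X \<inter> N \<noteq> {}) \<and>
     pairwise innerly_disjoint C \<and> N - {t} \<subseteq> \<Union> (inner_set ` C)"
  using critical_pair_iff_tight_at unfolding star_obstacle_def degree_at_eq_sdeg edges_between_eq_sdeg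
  by blast

lemma tight_at_union:
  assumes X: "tight_at t X" and Y: "tight_at t Y" and int: "inner_set X \<inter> inner_set Y \<noteq> {}"
    and out: "outer_set X \<union> outer_set Y \<noteq> V"
  shows "tight_at t (biset_union X Y)"
proof -
  note bs = tight_at_biset [OF X] tight_at_biset [OF Y]
  have "proper_biset V (biset_inter X Y)"
    using X Y int unfolding tight_at_def proper_biset_iff by auto
  then have "2 * k \<le> f (biset_inter X Y)" by (rule proper_ge)
  moreover have "f X \<le> 2 * k" "f Y \<le> 2 * k" using X Y by (auto simp: tight_at_def)
  ultimately have "f (biset_union X Y) \<le> 2 * k"
    using f_val_submod [OF bs finite_V, of k E] by linarith
  moreover have "proper_biset V (biset_union X Y)"
    using X Y out unfolding tight_at_def proper_biset_iff by auto
  moreover have "wall (biset_union X Y) = {t}"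
    using tight_at_notin [OF X] tight_at_notin [OF Y]
    by (auto simp: wall_def tight_at_outer [OF X] tight_at_outer [OF Y])
  ultimately show ?thesis by (simp add: tight_at_def)
qed

text \<open>When the outer-sets exhaust \<open>V\<close> the union is trivial, and the difference
  takes its place. Adding the bounds of \<open>tight_at_sdeg_le\<close> for \<open>X\<close> and
  \<open>Y\<close> leaves no edge from \<open>s\<close> to the common inner part, so the replacement
  loses no neighbor.\<close>

lemma tight_at_diff:
  assumes t: "t \<in> N" and X: "tight_at t X" and Y: "tight_at t Y"
    and out: "outer_set X \<union> outer_set Y = V"
  shows "tight_at t (biset_diff Y X)" and "inner_set X \<inter> inner_set Y \<inter> N = {}"
proof -
  note bs = tight_at_biset [OF X] tight_at_biset [OF Y]
  have sub: "inner_set X \<subseteq> V" "inner_set Y \<subseteq> V" "outer_set X \<noteq> V" "outer_set Y \<noteq> V"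
    "inner_set X \<noteq> {}" "inner_set Y \<noteq> {}"
    using X Y by (auto simp: tight_at_def proper_biset_iff)
  have "proper_biset V (biset_diff X Y)" "proper_biset V (biset_diff Y X)"
    using sub out t N_subset tight_at_notin [OF X] tight_at_notin [OF Y]
    unfolding proper_biset_iff biset_ops_simps tight_at_outer [OF X] tight_at_outer [OF Y] by blast+
  moreover have "f X \<le> 2 * k" "f Y \<le> 2 * k" using X Y by (auto simp: tight_at_def)
  ultimately have "f (biset_diff Y X) \<le> 2 * k"
    using f_val_diff [OF bs finite_V s_notin_V, of k E] proper_ge [of "biset_diff X Y"] by linarith
  moreover have "wall (biset_diff Y X) = {t}"
    using tight_at_notin [OF X] tight_at_notin [OF Y]
    by (auto simp: wall_def tight_at_outer [OF X] tight_at_outer [OF Y])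
  ultimately show "tight_at t (biset_diff Y X)"
    using \<open>proper_biset V (biset_diff Y X)\<close> by (simp add: tight_at_def)
  have "V = (inner_set X \<union> inner_set Y) \<union> {t}"
    using out by (auto simp: tight_at_outer [OF X] tight_at_outer [OF Y])
  then have "d V \<le> d (inner_set X \<union> inner_set Y) + d {t}"
    using s_notin_V by (intro sdeg_subset_union_le) auto
  moreover have "d (inner_set X) + d (inner_set Y)
      = d (inner_set X \<union> inner_set Y) + d (inner_set X \<inter> inner_set Y)"
    using sub s_notin_V by (intro sdeg_Un_Int) auto
  ultimately have "d (inner_set X \<inter> inner_set Y) = 0"
    using tight_at_sdeg_le [OF X] tight_at_sdeg_le [OF Y] by linarith
  then show "inner_set X \<inter> inner_set Y \<inter> N = {}"
    using neighbor_sdeg_pos [of _ "inner_set X \<inter> inner_set Y"] by fastforce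
qed

text \<open>Uncrossing two members that meet lowers the total size of the inner-sets, so a cover
  minimizing it is disjoint. The number of members would not serve as a measure: replacing
  \<open>Y\<close> by a difference need not reduce it.\<close>

lemma disjoint_tight_cover:
  assumes t: "t \<in> N" and unc: "uncovered t = {}"
  obtains C where "\<And>X. X \<in> C \<Longrightarrow> tight_at t X \<and> inner_set X \<inter> N \<noteq> {}"
    "pairwise innerly_disjoint C" "N - {t} \<subseteq> \<Union> (inner_set ` C)"
proof -
  define cover where "cover C \<longleftrightarrow> finite C \<and> (\<forall>X\<in>C. tight_at t X \<and> inner_set X \<inter> N \<noteq> {}) \<and>
    N - {t} \<subseteq> \<Union> (inner_set ` C)" for C
  define weight where "weight C = (\<Sum>X\<in>C. card (inner_set X))" for C :: "'a biset set"
  have weight_insert: "weight (insert X C) \<le> card (inner_set X) + weight C" if "finite C" for X C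
    using that by (cases "X \<in> C") (auto simp: weight_def insert_absorb)
  have "\<forall>u\<in>N - {t}. \<exists>Y. tight_at t Y \<and> u \<in> inner_set Y"
    using unc by (auto simp: uncovered_def covered_def)
  then obtain B where B: "\<And>u. u \<in> N - {t} \<Longrightarrow> tight_at t (B u) \<and> u \<in> inner_set (B u)" by metis
  have "cover (B ` (N - {t}))"
    using B finite_subset [OF N_subset finite_V] by (auto simp: cover_def)
  then obtain C where C: "cover C" and least: "\<And>G. cover G \<Longrightarrow> weight C \<le> weight G"
    using ex_has_least_nat [of cover _ weight] by metis
  have fin: "finite C" and tight: "\<And>X. X \<in> C \<Longrightarrow> tight_at t X"
    and meets: "\<And>X. X \<in> C \<Longrightarrow> inner_set X \<inter> N \<noteq> {}"
    and cov: "N - {t} \<subseteq> \<Union> (inner_set ` C)"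
    using C by (auto simp: cover_def)
  have "inner_set X \<inter> inner_set Y = {}" if XY: "X \<in> C" "Y \<in> C" "X \<noteq> Y" for X Y
  proof (rule ccontr)
    assume int: "inner_set X \<inter> inner_set Y \<noteq> {}"
    note T = XY(1,2) [THEN tight]
    have "inner_set X \<subseteq> V" "inner_set Y \<subseteq> V"
      using T by (auto simp: tight_at_def proper_biset_iff)
    then have finI: "finite (inner_set X)" "finite (inner_set Y)"
      using finite_V by (auto intro: finite_subset)
    let ?R = "C - {X, Y}"
    have "weight C = weight ({X, Y} \<union> ?R)" using XY by (simp add: insert_absorb)
    also have "\<dots> = weight {X, Y} + weight ?R"
      unfolding weight_def using fin by (intro sum.union_disjoint) auto
    also have "weight {X, Y} = card (inner_set X) + card (inner_set Y)" using XY by (simp add: weight_def)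
    finally have wC: "weight C = card (inner_set X) + card (inner_set Y) + weight ?R" .
    have pos: "0 < card (inner_set X \<inter> inner_set Y)" using int finI by (simp add: card_gt_0_iff)
    have R: "\<And>Z. Z \<in> ?R \<Longrightarrow> tight_at t Z \<and> inner_set Z \<inter> N \<noteq> {}"
      "N - {t} \<subseteq> inner_set X \<union> inner_set Y \<union> \<Union> (inner_set ` ?R)"
      using tight meets cov by blast+
    show False
    proof (cases "outer_set X \<union> outer_set Y = V")
      case False
      let ?U = "biset_union X Y"
      have "cover (insert ?U ?R)"
        using tight_at_union [OF T int False] fin R meets [OF XY(1)] unfolding cover_def by auto
      then have "weight C \<le> card (inner_set ?U) + weight ?R"
        using least weight_insert [of ?R ?U] fin by fastforce
      then show False
        using wC pos card_Un_Int [OF finI] by simp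
    next
      case True
      let ?D = "biset_diff Y X"
      note D = tight_at_diff [OF t T True]
      have inner_D: "inner_set ?D = inner_set Y - inner_set X"
        using tight_at_notin [OF T(2)] by (auto simp: tight_at_outer [OF T(1)])
      have "cover (insert ?D (insert X ?R))"
        using D T fin R meets [OF XY(1)] meets [OF XY(2)] tight_at_notin [OF T(2)] unfolding cover_def
        by (auto simp: tight_at_outer [OF T(1)])
      then have "weight C \<le> weight (insert ?D (insert X ?R))" by (rule least)
      also have "\<dots> \<le> card (inner_set ?D) + (card (inner_set X) + weight ?R)"
        using weight_insert [of "insert X ?R" ?D] weight_insert [of ?R X] fin by simp
      finally have "card (inner_set Y) \<le> card (inner_set Y - inner_set X)"
        using wC unfolding inner_D by linarith
      moreover have "card (inner_set Y - inner_set X) < card (inner_set Y)"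
        using finI int by (intro psubset_card_mono) auto
      ultimately show False by simp
    qed
  qed
  then have "pairwise innerly_disjoint C" by (simp add: pairwise_def innerly_disjoint_def)
  then show ?thesis using that tight meets cov by blast
qed

lemma tight_cover_count:
  assumes tight: "\<And>Y. Y \<in> C \<Longrightarrow> tight_at t Y" and cov: "N - {t} \<subseteq> \<Union> (inner_set ` C)"
    and Y0: "Y0 \<in> C"
  shows "d V + d {t} \<le> 2 * (d (\<Union> (inner_set ` (C - {Y0}))) + d {t})"
proof -
  let ?G = "\<Union> (inner_set ` (C - {Y0}))"
  have sub: "inner_set Y \<subseteq> V" "t \<in> V" if "Y \<in> C" for Y
    using tight [OF that] by (auto simp: tight_at_def proper_biset_iff wall_def)
  have "d V \<le> d ((?G \<union> inner_set Y0) \<union> {t})"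
    by (rule sdeg_neighbors_subset) (use cov in auto)
  also have "\<dots> \<le> d (?G \<union> inner_set Y0) + d {t}"
    using sub Y0 s_notin_V by (intro sdeg_subset_union_le) auto
  also have "d (?G \<union> inner_set Y0) \<le> d ?G + d (inner_set Y0)"
    using sub Y0 s_notin_V by (intro sdeg_subset_union_le) auto
  finally have "d V \<le> d ?G + d (inner_set Y0) + d {t}" by simp
  then show ?thesis using tight_at_sdeg_le [OF tight [OF Y0]] by presburger
qed

lemma tight_cover_two:
  assumes tV: "t \<in> V" and tight: "\<And>Y. Y \<in> C \<Longrightarrow> tight_at t Y"
    and large: "d V < 2 * d (\<Union> (inner_set ` C)) + d {t}"
  obtains A B where "A \<in> C" "B \<in> C" "A \<noteq> B"
proof (rule ccontr)
  assume "\<not> thesis"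
  then have "C = {} \<or> (\<exists>Y. C = {Y})" using that by blast
  then show False
  proof (elim disjE exE)
    assume "C = {}"
    moreover have "d {t} \<le> d V" by (rule sdeg_mono) (use tV in auto)
    ultimately show False using large by simp
  next
    fix Y assume "C = {Y}"
    then show False using tight_at_sdeg_le [OF tight [of Y]] large by simp
  qed
qed

lemma exists_admissible_pair:
  assumes even: "even (d V)" and pos: "0 < d V" and no_obst: "\<nexists>t C. star_obstacle k V s E t C"
  shows "\<exists>u\<in>V. \<exists>v\<in>V. {# Upair s u, Upair s v #} \<subseteq># E \<and> connected_2k_k k V (split_at s u v E)"
proof (rule ccontr)
  assume none: "\<not> ?thesis"
  have no_adm: "\<not> connected_2k_k k V (split_at s u v E)" if "u \<in> N" "v \<in> N" "u \<noteq> v \<or> 2 \<le> d {u}" for u v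
  proof -
    have "{# Upair s u, Upair s v #} \<subseteq># E"
      using that by (auto simp: pair_subset_mset_iff neighbors_iff)
    then show ?thesis using none that N_subset by blast
  qed
  have covered_all: "uncovered t = {}"
    if t: "t \<in> N" and no_tight: "\<And>r Z. r \<in> uncovered t \<Longrightarrow> tight_at r Z \<Longrightarrow> t \<notin> inner_set Z" for t
  proof (rule ccontr)
    assume ne: "uncovered t \<noteq> {}"
    have "\<exists>r\<in>uncovered t. connected_2k_k k V (split_at s t r E)"
      by (rule admissible_uncovered [OF t even ne]) (rule no_tight)
    then obtain r where "r \<in> uncovered t" "connected_2k_k k V (split_at s t r E)"
      by (rule bexE)
    then show False using no_adm [of t r] t by (auto simp: uncovered_def)
  qed
  define critical where "critical X \<longleftrightarrow> (\<exists>t\<in>N. tight_at t X \<and> inner_set X \<inter> N \<noteq> {})" for X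
  show False
  proof (cases "\<exists>X. critical X")
    case False
    have no_tight: "t \<notin> inner_set Z" if "t \<in> N" "r \<in> N" "tight_at r Z" for t r Z
      using False that by (auto simp: critical_def)
    obtain t where t: "t \<in> N" using sdeg_pos_imp_neighbor [OF pos] by auto
    have "uncovered t = {}"
      using no_tight t by (intro covered_all) (auto simp: uncovered_def)
    moreover have "covered t = {}" using no_tight t by (auto simp: covered_def)
    ultimately have "N \<subseteq> {t}" by (auto simp: uncovered_def)
    then have dt: "d V \<le> d {t}" by (intro sdeg_neighbors_subset) auto
    then have "2 \<le> d {t}" using even pos by (auto elim!: evenE)
    moreover from this have "{# Upair s t, Upair s t #} \<subseteq># E" by (auto simp: pair_subset_mset_iff)
    ultimately obtain X where X: "proper_biset V X" "t \<in> inner_set X" "f X \<le> 2 * k + 1"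
      using not_connected_split_at [of t t] no_adm [of t t] t tight_at_notin N_subset by blast
    \<comment> \<open>All edges at \<open>s\<close> go to \<open>t\<close>, so this bi-set would
      hold all of them instead of at most half.\<close>
    have "d {t} \<le> d (inner_set X)" using X by (intro sdeg_mono) auto
    then show False using proper_f_compl [OF X(1)] X(3) dt \<open>2 \<le> d {t}\<close> by linarith
  next
    case True
    have "critical X \<Longrightarrow> card (outer_set X) < Suc (card V)" for X
      using card_mono [OF finite_V, of "outer_set X"]
      by (auto simp: critical_def tight_at_def proper_biset_iff)
    then obtain X where X: "critical X" and max: "\<And>Z. critical Z \<Longrightarrow> card (outer_set Z) \<le> card (outer_set X)"
      using ex_has_greatest_nat [of critical _ "\<lambda>Z. card (outer_set Z)" "Suc (card V)"] True
      by (metis order.strict_implies_order)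
    then obtain t where t: "t \<in> N" and T: "tight_at t X" and meets: "inner_set X \<inter> N \<noteq> {}"
      by (auto simp: critical_def)
    \<comment> \<open>A tight bi-set at an uncovered \<open>r\<close> that contains \<open>t\<close>
      would be critical and, by \<open>tight_at_imp_subset\<close>, have a strictly larger outer-set
      than \<open>X\<close>.\<close>
    have unc: "uncovered t = {}"
    proof (rule covered_all [OF t], rule notI)
      fix r Z assume r: "r \<in> uncovered t" and Z: "tight_at r Z" and tZ: "t \<in> inner_set Z"
      have rN: "r \<in> N" "r \<noteq> t" "r \<notin> inner_set X" using r T by (auto simp: uncovered_def covered_def)
      have "inner_set X \<subseteq> inner_set Z"
        using rN by (intro tight_at_imp_subset [OF T Z t tZ]) (simp add: tight_at_outer [OF T])
      then have "outer_set X \<subset> outer_set Z"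
        using tZ rN by (auto simp: tight_at_outer [OF T] tight_at_outer [OF Z])
      then have "card (outer_set X) < card (outer_set Z)"
        using Z finite_V by (intro psubset_card_mono)
          (auto simp: tight_at_def proper_biset_iff intro: finite_subset)
      moreover have "critical Z" using rN t Z tZ by (auto simp: critical_def)
      ultimately show False using max [of Z] by simp
    qed
    obtain C where C: "\<And>Y. Y \<in> C \<Longrightarrow> tight_at t Y \<and> inner_set Y \<inter> N \<noteq> {}"
      "pairwise innerly_disjoint C" "N - {t} \<subseteq> \<Union> (inner_set ` C)"
      using disjoint_tight_cover [OF t unc] by blast
    have "even (d {t})"
    proof (rule ccontr)
      assume "odd (d {t})"
      then have "star_obstacle k V s E t C" using C t even by (auto simp: star_obstacle_iff)
      then show False using no_obst by blast
    qed
    then have dt: "2 \<le> d {t}" using t by (auto simp: neighbors_iff elim!: evenE)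
    have "inner_set Y \<subseteq> V" if "Y \<in> C" for Y
      using C(1) [OF that] by (auto simp: tight_at_def proper_biset_iff)
    then have tV: "t \<in> V" and subV: "\<Union> (inner_set ` C) \<subseteq> V" using t N_subset by auto
    have "d V \<le> d (\<Union> (inner_set ` C) \<union> {t})"
      by (rule sdeg_neighbors_subset) (use C in auto)
    also have "\<dots> \<le> d (\<Union> (inner_set ` C)) + d {t}"
      using subV tV s_notin_V by (intro sdeg_subset_union_le) auto
    finally have le: "d V \<le> d (\<Union> (inner_set ` C)) + d {t}" .
    obtain u where "u \<in> inner_set X" "u \<in> N" using meets by auto
    then have "1 \<le> d (inner_set X)" by (intro neighbor_sdeg_pos)
    then have "d {t} < d V" using tight_at_sdeg_le [OF T] by linarith
    then have "d V < 2 * d (\<Union> (inner_set ` C)) + d {t}" using le by linarith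
    then obtain A B where "A \<in> C" "B \<in> C" "A \<noteq> B"
      using tight_cover_two [OF tV, of C] C(1) by blast
    then have "connected_2k_k k V (split_at s t t E)"
      using le pos by (intro admissible_center_pair [OF t dt even _ C(2)]) (use C(1) in auto)
    then show False using no_adm [of t t] t dt by blast
  qed
qed

text \<open>\<open>C\<close> stands for an old obstacle seen after another splitting-off, where a
  member may have f equal to 2k + 1. Parity excludes the center \<open>t\<close>. If a member P of
  an obstacle with center \<open>x\<close> shares a neighbor with some Y in \<open>C\<close> that
  avoids \<open>x\<close>, then \<open>t\<close> is inner in P, as otherwise \<open>t\<close> and
  \<open>x\<close> are both in the wall of the union. By disjointness a single P collects all these
  neighbors and \<open>t\<close>, which is half of the edges and too much.\<close>

lemma no_obstacle_if_other_star:
  assumes even_t: "even (d {t})" and tV: "t \<in> V"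
    and C: "\<And>Y. Y \<in> C \<Longrightarrow> biset_of V Y \<and> wall Y = {t} \<and> f Y \<le> 2 * k + 1 \<and> (f Y \<le> 2 * k \<or> 2 \<le> d (inner_set Y))"
    and large: "\<And>x. d V \<le> 2 * (d (\<Union> (inner_set ` {Y \<in> C. x \<notin> inner_set Y})) + d {t})"
  shows "\<not> star_obstacle k V s E x Z"
proof
  assume "star_obstacle k V s E x Z"
  then have x: "x \<in> N" "odd (d {x})" and Z: "\<And>P. P \<in> Z \<Longrightarrow> tight_at x P"
    and disj: "pairwise innerly_disjoint Z" and cov: "N - {x} \<subseteq> \<Union> (inner_set ` Z)"
    by (auto simp: star_obstacle_iff)
  have xt: "x \<noteq> t" using x even_t by auto
  let ?G = "\<Union> (inner_set ` {Y \<in> C. x \<notin> inner_set Y})"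
  have in_Z: "\<exists>P\<in>Z. a \<in> inner_set P \<and> t \<in> inner_set P" if a: "a \<in> N" "a \<in> ?G \<union> {t}" for a
  proof (cases "a = t")
    case True
    then show ?thesis using a cov xt by blast
  next
    case False
    then obtain Y where Y: "Y \<in> C" "x \<notin> inner_set Y" "a \<in> inner_set Y" using a by auto
    then have "a \<noteq> x" by auto
    then obtain P where P: "P \<in> Z" "a \<in> inner_set P" using a cov by auto
    note TP = Z [OF P(1)]
    have Y': "biset_of V Y" "wall Y = {t}" "f Y \<le> 2 * k + 1" "f Y \<le> 2 * k \<or> 2 \<le> d (inner_set Y)"
      using C [OF Y(1)] by auto
    have outY: "outer_set Y = insert t (inner_set Y)" "t \<notin> inner_set Y"
      using Y' by (auto simp: wall_def biset_of_def)
    have "t \<in> inner_set P"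
    proof (rule ccontr)
      assume tP: "t \<notin> inner_set P"
      let ?U = "biset_union Y P" and ?I = "biset_inter Y P"
      have "proper_biset V ?I"
        using Y Y' P TP unfolding tight_at_def proper_biset_iff biset_of_def by auto
      then have "2 * k \<le> f ?I" by (rule proper_ge)
      moreover have "{t, x} \<subseteq> wall ?U"
        using tP Y outY tight_at_notin [OF TP] xt by (auto simp: wall_def tight_at_outer [OF TP])
      then have "d (inner_set ?U) + 2 * k \<le> f ?U"
        using Y' tight_at_biset [OF TP] xt by (intro f_ge_two_walls [of ?U t x]) (auto simp: biset_of_def)
      moreover have "f ?I + f ?U \<le> f Y + f P"
        by (rule f_val_submod [OF Y'(1) tight_at_biset [OF TP] finite_V])
      moreover have "f P \<le> 2 * k" using TP by (simp add: tight_at_def)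
      moreover have "1 \<le> d (inner_set ?U)" using a Y by (intro neighbor_sdeg_pos [of a]) auto
      moreover have "d (inner_set Y) \<le> d (inner_set ?U)" by (intro sdeg_mono) auto
      \<comment> \<open>If \<open>f Y\<close> is at most 2k, one edge from \<open>s\<close> to the
        union suffices; otherwise the two edges to \<open>Y\<close> beat the surplus 1.\<close>
      ultimately show False using Y'(3,4) by linarith
    qed
    then show ?thesis using P by blast
  qed
  have GV: "?G \<subseteq> V" using C by (fastforce simp: biset_of_def)
  have tG: "t \<notin> ?G" using C by (fastforce simp: wall_def)
  have dG: "d (?G \<union> {t}) = d ?G + d {t}"
    using GV tG tV s_notin_V by (intro sdeg_Un_disjoint) auto
  have "0 < d V" using x N_subset neighbor_sdeg_pos [of x V] by fastforce
  then have "0 < d (?G \<union> {t})" using large [of x] dG by presburger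
  then obtain a where "a \<in> ?G \<union> {t}" "a \<in> N"
    using sdeg_pos_imp_neighbor [of s E "?G \<union> {t}" V] GV tV by blast
  then obtain P where P: "P \<in> Z" "t \<in> inner_set P" using in_Z by blast
  have "(?G \<union> {t}) \<inter> N \<subseteq> inner_set P"
  proof
    fix b assume "b \<in> (?G \<union> {t}) \<inter> N"
    then obtain Q where "Q \<in> Z" "b \<in> inner_set Q" "t \<in> inner_set Q" using in_Z by blast
    moreover from this have "Q = P"
      using disj P unfolding pairwise_def innerly_disjoint_def by blast
    ultimately show "b \<in> inner_set P" by simp
  qed
  then have "d (?G \<union> {t}) \<le> d (inner_set P)"
    by (rule sdeg_neighbors_subset) (use GV tV in auto)
  then have "d V \<le> 2 * d (inner_set P)" using large [of x] dG by presburger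
  then show False using tight_at_sdeg_le [OF Z [OF P(1)]] x by (auto simp: neighbors_iff)
qed

end

section \<open>Splitting-off without creating an obstacle\<close>

context splitting_graph begin

lemma obstacle_count:
  assumes obst: "star_obstacle k V s E t C" and Y: "Y \<in> C"
  shows "d V + d {t} \<le> 2 * d (\<Union> (inner_set ` (C - {Y}))) + 2 * d {t}"
proof -
  have "d V + d {t} \<le> 2 * (d (\<Union> (inner_set ` (C - {Y}))) + d {t})"
    by (rule tight_cover_count [OF _ _ Y]) (use obst in \<open>auto simp: star_obstacle_iff\<close>)
  then show ?thesis by (simp add: distrib_left)
qed

lemma obstacle_separate:
  assumes obst: "star_obstacle k V s E t C"
  obtains Y where "Y \<in> C" "\<And>Z. Z \<in> C - {Y} \<Longrightarrow> x \<notin> inner_set Z"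
proof (cases "\<exists>Y\<in>C. x \<in> inner_set Y")
  case True
  then obtain Y where Y: "Y \<in> C" "x \<in> inner_set Y" by auto
  have "x \<notin> inner_set Z" if "Z \<in> C - {Y}" for Z
    using that Y obst unfolding star_obstacle_iff pairwise_def innerly_disjoint_def by blast
  then show ?thesis using that Y by blast
next
  case False
  \<comment> \<open>Without members all edges at \<open>s\<close> would go to \<open>t\<close>, but
    \<open>d V\<close> is even and \<open>d {t}\<close> is odd.\<close>
  have "C \<noteq> {}"
  proof
    assume "C = {}"
    then have "N \<subseteq> {t}" "t \<in> V" using obst by (auto simp: star_obstacle_iff neighbors_def)
    then have "d V \<le> d {t}" "d {t} \<le> d V"
      by (auto intro: sdeg_neighbors_subset sdeg_mono)
    then show False using obst by (auto simp: star_obstacle_iff)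
  qed
  then show ?thesis using that False by blast
qed

text \<open>The degree at \<open>t\<close> is odd before the splitting-off too, so \<open>t\<close>
  must have uncovered neighbors. Each member of \<open>C\<close> was tight already unless it
  contains both \<open>u\<close> and \<open>v\<close>, and this exceptional member is the only one
  that can contain the new partner \<open>r\<close>.\<close>

lemma good_split_avoiding_center:
  assumes no_obst: "\<nexists>t C. star_obstacle k V s E t C" and even: "even (d V)"
    and uv: "u \<in> V" "v \<in> V" and sub: "{# Upair s u, Upair s v #} \<subseteq># E"
    and conn1: "connected_2k_k k V (split_at s u v E)"
    and obst: "star_obstacle k V s (split_at s u v E) t C" and tuv: "t \<noteq> u" "t \<noteq> v"
  shows "\<exists>r\<in>V. {# Upair s t, Upair s r #} \<subseteq># E \<and> connected_2k_k k V (split_at s t r E) \<and>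
    (\<forall>x Z. \<not> star_obstacle k V s (split_at s t r E) x Z)"
proof -
  interpret H1: splitting_graph k V s "split_at s u v E"
    using k_ge_2 graph_with_special_split_at [OF graph uv] conn1 by unfold_locales
  note deg1 = sdeg_split_at [OF _ s_notin_V uv sub]
  have tN1: "t \<in> H1.N" and odd1: "odd (H1.d {t})" and even1: "even (H1.d V)"
    and cov1: "H1.N - {t} \<subseteq> \<Union> (inner_set ` C)" and disj: "pairwise innerly_disjoint C"
    and tight1: "\<And>Y. Y \<in> C \<Longrightarrow> H1.tight_at t Y" and meets1: "\<And>Y. Y \<in> C \<Longrightarrow> inner_set Y \<inter> H1.N \<noteq> {}"
    using obst by (auto simp: H1.star_obstacle_iff)
  have tV: "t \<in> V" using tN1 H1.N_subset by auto
  have outY: "outer_set Y = insert t (inner_set Y)" and tY: "t \<notin> inner_set Y"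
    and bsY: "biset_of V Y" and proper: "proper_biset V Y" and wallY: "wall Y = {t}"
    and subY: "inner_set Y \<subseteq> V" if "Y \<in> C" for Y
    using H1.tight_at_outer [OF tight1 [OF that]] H1.tight_at_notin [OF tight1 [OF that]]
      H1.tight_at_biset [OF tight1 [OF that]] tight1 [OF that]
    by (auto simp: H1.tight_at_def biset_of_def)
  have dt: "d {t} = H1.d {t}" using deg1 [of "{t}"] tuv tV by simp
  have dV: "d V = H1.d V + 2" using deg1 [of V] uv by simp
  have tN: "t \<in> N" using tN1 dt by (simp add: neighbors_iff)
  \<comment> \<open>A member with exactly one of \<open>u\<close>, \<open>v\<close> is entered by
    the new edge, because its wall is {t}; so only both ends together change f.\<close>
  have fY: "f Y \<le> 2 * k + (if u \<in> inner_set Y \<and> v \<in> inner_set Y then 2 else 0)" if "Y \<in> C" for Y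
  proof -
    have "enters (Upair u v) Y \<longleftrightarrow> (u \<in> inner_set Y) \<noteq> (v \<in> inner_set Y)"
      using tuv by (auto simp: enters_Upair outY [OF that])
    moreover have "H1.f Y \<le> 2 * k" using tight1 [OF that] by (simp add: H1.tight_at_def)
    ultimately show ?thesis
      using f_val_split_at [OF bsY [OF that] s_notin_V sub, of k] by (auto split: if_splits)
  qed
  have tight: "tight_at t Y" if "Y \<in> C" "u \<notin> inner_set Y \<or> v \<notin> inner_set Y" for Y
    using fY [OF that(1)] that proper wallY by (auto simp: tight_at_def)
  have "uncovered t \<noteq> {}"
  proof
    assume "uncovered t = {}"
    then obtain D where "\<And>X. X \<in> D \<Longrightarrow> tight_at t X \<and> inner_set X \<inter> N \<noteq> {}"
      "pairwise innerly_disjoint D" "N - {t} \<subseteq> \<Union> (inner_set ` D)"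
      using disjoint_tight_cover [OF tN] by blast
    then have "star_obstacle k V s E t D" using tN even odd1 dt by (simp add: star_obstacle_iff)
    then show False using no_obst by blast
  qed
  moreover have "d V \<le> 2 * (d (covered t) + d {t})"
  proof -
    obtain Y0 where Y0: "Y0 \<in> C" "\<And>Z. Z \<in> C - {Y0} \<Longrightarrow> u \<notin> inner_set Z"
      using H1.obstacle_separate [OF obst] by blast
    let ?G = "\<Union> (inner_set ` (C - {Y0}))"
    have GV: "?G \<subseteq> V" using subY by auto
    have "?G \<inter> N \<subseteq> covered t" using Y0 tight by (fastforce simp: covered_def)
    then have "d ?G \<le> d (covered t)" by (rule sdeg_neighbors_subset [OF _ GV])
    moreover have "H1.d ?G \<le> d ?G" using deg1 [OF GV] by linarith
    moreover have "H1.d V + H1.d {t} \<le> 2 * H1.d ?G + 2 * H1.d {t}"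
      by (rule H1.obstacle_count [OF obst Y0(1)])
    ultimately have "H1.d V + H1.d {t} \<le> 2 * (d (covered t) + d {t})" using dt by presburger
    \<comment> \<open>The left side is odd, which yields 1 by rounding, and \<open>H1.d {t}\<close>
      is at least 1. Together they make up for the two edges split off.\<close>
    then show ?thesis using odd1 even1 dV by presburger
  qed
  ultimately have "\<exists>r\<in>uncovered t. connected_2k_k k V (split_at s t r E)"
    by (rule admissible_uncovered_if_large [OF tN even])
  then obtain r where r: "r \<in> uncovered t" and conn3: "connected_2k_k k V (split_at s t r E)"
    by (rule bexE)
  have rN: "r \<in> N" "r \<noteq> t" and r_tight: "\<And>Y. tight_at t Y \<Longrightarrow> r \<notin> inner_set Y"
    using r by (auto simp: uncovered_def covered_def)
  have rV: "r \<in> V" using rN N_subset by auto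
  have sub3: "{# Upair s t, Upair s r #} \<subseteq># E"
    using tN rN by (auto simp: pair_subset_mset_iff neighbors_iff)
  interpret H3: splitting_graph k V s "split_at s t r E"
    using k_ge_2 graph_with_special_split_at [OF graph tV rV] conn3 by unfold_locales
  note deg3 = sdeg_split_at [OF _ s_notin_V tV rV sub3]
  have both: "u \<in> inner_set Y \<and> v \<in> inner_set Y" if "Y \<in> C" "r \<in> inner_set Y" for Y
    using tight [OF that(1)] r_tight that(2) by blast
  \<comment> \<open>Otherwise \<open>r\<close> is still a neighbor after splitting off at
    \<open>u\<close> and \<open>v\<close>, hence in another member, which by \<open>both\<close>
    also contains \<open>u\<close>. Thus splitting off at \<open>r\<close> lowers f of the
    exceptional member from at most 2k + 2 to at most 2k + 1.\<close>
  have r_both: "r \<in> inner_set Y" if Y: "Y \<in> C" "u \<in> inner_set Y" "v \<in> inner_set Y" for Y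
  proof (rule ccontr)
    assume "r \<notin> inner_set Y"
    then have "r \<noteq> u" "r \<noteq> v" using Y by auto
    then have "r \<in> H1.N" using rN deg1 [of "{r}"] by (auto simp: neighbors_iff)
    then obtain Z where Z: "Z \<in> C" "r \<in> inner_set Z" using cov1 rN by auto
    then have "u \<in> inner_set Z" using both by blast
    moreover have "Z \<noteq> Y" using Z \<open>r \<notin> inner_set Y\<close> by auto
    ultimately show False
      using disj Y Z unfolding pairwise_def innerly_disjoint_def by blast
  qed
  have d3t: "H3.d {t} + 1 = H1.d {t}" using deg3 [of "{t}"] rN dt tV by simp
  have d3V: "H3.d V = H1.d V" using deg3 [of V] tV rV dV by simp
  have "\<not> star_obstacle k V s (split_at s t r E) x Z" for x Z
  proof (rule H3.no_obstacle_if_other_star [where t = t and C = C])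
    show "even (H3.d {t})" using d3t odd1 by presburger
    show "t \<in> V" by (rule tV)
  next
    fix Y assume Y: "Y \<in> C"
    have "\<not> enters (Upair t r) Y" using tY [OF Y] by (auto simp: enters_Upair outY [OF Y])
    then have f3: "H3.f Y + of_bool (r \<in> inner_set Y) = f Y"
      using f_val_split_at [OF bsY [OF Y] s_notin_V sub3, of k] tY [OF Y] by simp
    have "H3.f Y \<le> 2 * k + 1 \<and> (H3.f Y \<le> 2 * k \<or> 2 \<le> H3.d (inner_set Y))"
    proof (cases "u \<in> inner_set Y \<and> v \<in> inner_set Y")
      case True
      then have rY: "r \<in> inner_set Y" using r_both Y by blast
      obtain a where "a \<in> H1.N" "a \<in> inner_set Y" using meets1 [OF Y] by auto
      then have "1 \<le> H1.d (inner_set Y)" by (rule H1.neighbor_sdeg_pos)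
      moreover have "H3.d (inner_set Y) + 1 = d (inner_set Y)"
        using deg3 [OF subY [OF Y]] rY tY [OF Y] by simp
      moreover have "H1.d (inner_set Y) + 2 = d (inner_set Y)"
        using deg1 [OF subY [OF Y]] True by simp
      moreover have "H3.f Y + 1 \<le> 2 * k + 2" using f3 rY fY [OF Y] True by simp
      ultimately show ?thesis by linarith
    next
      case False
      then show ?thesis using f3 fY [OF Y] by auto
    qed
    then show "biset_of V Y \<and> wall Y = {t} \<and> H3.f Y \<le> 2 * k + 1 \<and> (H3.f Y \<le> 2 * k \<or> 2 \<le> H3.d (inner_set Y))"
      using bsY [OF Y] wallY [OF Y] by blast
  next
    fix x
    let ?G = "\<Union> (inner_set ` {Y \<in> C. x \<notin> inner_set Y})"
    obtain Y0 where Y0: "Y0 \<in> C" "\<And>Z. Z \<in> C - {Y0} \<Longrightarrow> x \<notin> inner_set Z"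
      using H1.obstacle_separate [OF obst] by blast
    have GV: "?G \<subseteq> V" using subY by auto
    have "t \<notin> ?G" using tY by auto
    \<comment> \<open>Losing the edge to \<open>r\<close> is no worse than losing the one to
      \<open>u\<close>, so the new degree of \<open>?G\<close> is at least the one in the graph with
      the obstacle.\<close>
    moreover have "r \<in> ?G \<Longrightarrow> u \<in> ?G" using both by blast
    ultimately have "H1.d ?G \<le> H3.d ?G"
      using deg1 [OF GV] deg3 [OF GV] by (auto simp: of_bool_def split: if_splits)
    moreover have "H1.d (\<Union> (inner_set ` (C - {Y0}))) \<le> H1.d ?G"
      using Y0 by (intro sdeg_mono) auto
    moreover note H1.obstacle_count [OF obst Y0(1)]
    ultimately have "H1.d V + H1.d {t} \<le> 2 * H3.d ?G + 2 * (H3.d {t} + 1)" using d3t by presburger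
    \<comment> \<open>Rounding, as the left side is odd, and \<open>H1.d {t}\<close> being positive
      pay for the edge lost at \<open>t\<close>.\<close>
    then show "H3.d V \<le> 2 * (H3.d ?G + H3.d {t})" using d3V d3t odd1 even1 by presburger
  qed
  then show ?thesis using rV sub3 conn3 by blast
qed

text \<open>Here the degree at \<open>t\<close> was even, hence at least 2, and splitting off two
  edges to \<open>t\<close> keeps it even. Without the member that may contain \<open>v\<close>, the
  rest of \<open>C\<close> was tight before and satisfies \<open>admissible_center_pair\<close>. A
  member with \<open>v\<close> has f at most 2k + 1, and the edge to \<open>v\<close> besides a
  surviving one gives the two edges asked for by \<open>no_obstacle_if_other_star\<close>.\<close>

lemma good_split_at_center:
  assumes tv: "t \<in> V" "v \<in> V" "t \<noteq> v" and even: "even (d V)" and sub: "{# Upair s t, Upair s v #} \<subseteq># E"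
    and conn1: "connected_2k_k k V (split_at s t v E)"
    and obst: "star_obstacle k V s (split_at s t v E) t C"
  shows "{# Upair s t, Upair s t #} \<subseteq># E \<and> connected_2k_k k V (split_at s t t E) \<and>
    (\<forall>x Z. \<not> star_obstacle k V s (split_at s t t E) x Z)"
proof -
  interpret H1: splitting_graph k V s "split_at s t v E"
    using k_ge_2 graph_with_special_split_at [OF graph tv(1,2)] conn1 by unfold_locales
  note deg1 = sdeg_split_at [OF _ s_notin_V tv(1,2) sub]
  have tN1: "t \<in> H1.N" and odd1: "odd (H1.d {t})" and even1: "even (H1.d V)"
    and disj: "pairwise innerly_disjoint C"
    and tight1: "\<And>Y. Y \<in> C \<Longrightarrow> H1.tight_at t Y" and meets1: "\<And>Y. Y \<in> C \<Longrightarrow> inner_set Y \<inter> H1.N \<noteq> {}"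
    using obst by (auto simp: H1.star_obstacle_iff)
  have tV: "t \<in> V" by (rule tv(1))
  have outY: "outer_set Y = insert t (inner_set Y)" and tY: "t \<notin> inner_set Y"
    and bsY: "biset_of V Y" and proper: "proper_biset V Y" and wallY: "wall Y = {t}"
    and subY: "inner_set Y \<subseteq> V" if "Y \<in> C" for Y
    using H1.tight_at_outer [OF tight1 [OF that]] H1.tight_at_notin [OF tight1 [OF that]]
      H1.tight_at_biset [OF tight1 [OF that]] tight1 [OF that]
    by (auto simp: H1.tight_at_def biset_of_def)
  have dt: "d {t} = H1.d {t} + 1" using deg1 [of "{t}"] tv by simp
  have dV: "d V = H1.d V + 2" using deg1 [of V] tv by simp
  have tN: "t \<in> N" using tN1 dt by (simp add: neighbors_iff)
  have dt2: "2 \<le> d {t}" using odd1 dt by presburger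
  have fY: "f Y \<le> 2 * k + of_bool (v \<in> inner_set Y)" if "Y \<in> C" for Y
  proof -
    have "\<not> enters (Upair t v) Y" using tY [OF that] by (auto simp: enters_Upair outY [OF that])
    moreover have "H1.f Y \<le> 2 * k" using tight1 [OF that] by (simp add: H1.tight_at_def)
    ultimately show ?thesis
      using f_val_split_at [OF bsY [OF that] s_notin_V sub, of k] tY [OF that] by simp
  qed
  have d_le: "H1.d A \<le> d A" if "A \<subseteq> V" for A using deg1 [OF that] by linarith
  have conn3: "connected_2k_k k V (split_at s t t E)"
  proof -
    obtain Y0 where Y0: "Y0 \<in> C" "\<And>Z. Z \<in> C - {Y0} \<Longrightarrow> v \<notin> inner_set Z"
      using H1.obstacle_separate [OF obst] by blast
    let ?G = "\<Union> (inner_set ` (C - {Y0}))"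
    have GV: "?G \<subseteq> V" using subY by auto
    note count = H1.obstacle_count [OF obst Y0(1)]
    have "H1.d V < 2 * H1.d ?G + H1.d {t}" using count odd1 even1 by presburger
    then obtain A B where AB: "A \<in> C - {Y0}" "B \<in> C - {Y0}" "A \<noteq> B"
      using H1.tight_cover_two [OF tV, of "C - {Y0}"] tight1 by blast
    show ?thesis
    proof (rule admissible_center_pair [OF tN dt2 even _ _ AB])
      show "tight_at t Y" if "Y \<in> C - {Y0}" for Y
        using that fY [of Y] Y0(2) [OF that] proper wallY by (simp add: tight_at_def)
      show "pairwise innerly_disjoint (C - {Y0})" using disj by (rule pairwise_subset) auto
      show "d V < 2 * (d ?G + d {t})" using count d_le [OF GV] dV dt odd1 by presburger
    qed
  qed
  have sub3: "{# Upair s t, Upair s t #} \<subseteq># E" using dt2 by (auto simp: pair_subset_mset_iff)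
  interpret H3: splitting_graph k V s "split_at s t t E"
    using k_ge_2 graph_with_special_split_at [OF graph tV tV] conn3 by unfold_locales
  note deg3 = sdeg_split_at [OF _ s_notin_V tV tV sub3]
  have d3t: "H3.d {t} + 1 = H1.d {t}" using deg3 [of "{t}"] dt tV by simp
  have d3V: "H3.d V = H1.d V" using deg3 [of V] tV dV by simp
  have d3: "H3.d A = d A" if "A \<subseteq> V" "t \<notin> A" for A using deg3 [OF that(1)] that(2) by simp
  have "\<not> star_obstacle k V s (split_at s t t E) x Z" for x Z
  proof (rule H3.no_obstacle_if_other_star [where t = t and C = C])
    show "even (H3.d {t})" using d3t odd1 by presburger
    show "t \<in> V" by (rule tV)
  next
    fix Y assume Y: "Y \<in> C"
    have "\<not> enters (Upair t t) Y" using tY [OF Y] by (auto simp: enters_Upair)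
    then have f3: "H3.f Y = f Y"
      using f_val_split_at [OF bsY [OF Y] s_notin_V sub3, of k] tY [OF Y] by simp
    have "H3.f Y \<le> 2 * k + 1 \<and> (H3.f Y \<le> 2 * k \<or> 2 \<le> H3.d (inner_set Y))"
    proof (cases "v \<in> inner_set Y")
      case True
      obtain a where "a \<in> H1.N" "a \<in> inner_set Y" using meets1 [OF Y] by auto
      then have "1 \<le> H1.d (inner_set Y)" by (rule H1.neighbor_sdeg_pos)
      moreover have "H3.d (inner_set Y) = d (inner_set Y)" by (rule d3 [OF subY [OF Y] tY [OF Y]])
      moreover have "H1.d (inner_set Y) + 1 = d (inner_set Y)"
        using deg1 [OF subY [OF Y]] tY [OF Y] True by simp
      ultimately show ?thesis using f3 fY [OF Y] True by simp
    next
      case False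
      then show ?thesis using f3 fY [OF Y] by auto
    qed
    then show "biset_of V Y \<and> wall Y = {t} \<and> H3.f Y \<le> 2 * k + 1 \<and> (H3.f Y \<le> 2 * k \<or> 2 \<le> H3.d (inner_set Y))"
      using bsY [OF Y] wallY [OF Y] by blast
  next
    fix x
    let ?G = "\<Union> (inner_set ` {Y \<in> C. x \<notin> inner_set Y})"
    obtain Y0 where Y0: "Y0 \<in> C" "\<And>Z. Z \<in> C - {Y0} \<Longrightarrow> x \<notin> inner_set Z"
      using H1.obstacle_separate [OF obst] by blast
    have GV: "?G \<subseteq> V" using subY by auto
    have "t \<notin> ?G" using tY by auto
    then have "H1.d ?G \<le> H3.d ?G" using d_le [OF GV] d3 [OF GV] by simp
    moreover have "H1.d (\<Union> (inner_set ` (C - {Y0}))) \<le> H1.d ?G"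
      using Y0 by (intro sdeg_mono) auto
    moreover note H1.obstacle_count [OF obst Y0(1)]
    ultimately have "H1.d V + H1.d {t} \<le> 2 * H3.d ?G + 2 * (H3.d {t} + 1)" using d3t by presburger
    then show "H3.d V \<le> 2 * (H3.d ?G + H3.d {t})" using d3V d3t odd1 even1 by presburger
  qed
  then show ?thesis using sub3 conn3 by blast
qed

text \<open>As \<open>t\<close> is not inner in any member, splitting off two edges to
  \<open>t\<close> preserves f on \<open>C\<close>, the parity at \<open>t\<close>, and the other
  neighbors; the obstacle was there before.\<close>

lemma obstacle_if_center_pair_split:
  assumes tV: "t \<in> V" and even: "even (d V)" and sub: "{# Upair s t, Upair s t #} \<subseteq># E"
    and conn1: "connected_2k_k k V (split_at s t t E)"
    and obst: "star_obstacle k V s (split_at s t t E) t C"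
  shows "star_obstacle k V s E t C"
proof -
  interpret H1: splitting_graph k V s "split_at s t t E"
    using k_ge_2 graph_with_special_split_at [OF graph tV tV] conn1 by unfold_locales
  note deg1 = sdeg_split_at [OF _ s_notin_V tV tV sub]
  have N: "a \<in> N \<longleftrightarrow> a \<in> H1.N" if "a \<noteq> t" for a
    using deg1 [of "{a}"] that by (auto simp: neighbors_iff)
  have dt: "d {t} = H1.d {t} + 2" using deg1 [of "{t}"] tV by simp
  have "tight_at t Y \<and> inner_set Y \<inter> N \<noteq> {}" if "Y \<in> C" for Y
  proof -
    have T: "H1.tight_at t Y" and "inner_set Y \<inter> H1.N \<noteq> {}"
      using obst that by (auto simp: H1.star_obstacle_iff)
    then obtain a where a: "a \<in> inner_set Y" "a \<in> H1.N" by auto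
    note tY = H1.tight_at_notin [OF T]
    have "\<not> enters (Upair t t) Y" using tY by (auto simp: enters_Upair)
    then have "H1.f Y = f Y"
      using f_val_split_at [OF H1.tight_at_biset [OF T] s_notin_V sub, of k] tY by simp
    then have "tight_at t Y" using T by (simp add: H1.tight_at_def tight_at_def)
    moreover have "a \<noteq> t" using a tY by auto
    then have "inner_set Y \<inter> N \<noteq> {}" using a N [of a] by auto
    ultimately show ?thesis by blast
  qed
  moreover have "N - {t} \<subseteq> \<Union> (inner_set ` C)" using obst N by (auto simp: H1.star_obstacle_iff)
  ultimately show ?thesis
    using obst dt even tV by (auto simp: H1.star_obstacle_iff star_obstacle_iff neighbors_iff)
qed

lemma exists_good_split:
  assumes no_obst: "\<nexists>t C. star_obstacle k V s E t C" and even: "even (d V)" and pos: "0 < d V"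
  shows "\<exists>u\<in>V. \<exists>v\<in>V. {# Upair s u, Upair s v #} \<subseteq># E \<and> connected_2k_k k V (split_at s u v E) \<and>
    (\<forall>x Z. \<not> star_obstacle k V s (split_at s u v E) x Z)"
proof -
  obtain u v where uv: "u \<in> V" "v \<in> V" and sub: "{# Upair s u, Upair s v #} \<subseteq># E"
    and conn1: "connected_2k_k k V (split_at s u v E)"
    using exists_admissible_pair [OF even pos no_obst] by (elim bexE conjE)
  show ?thesis
  proof (cases "\<forall>x Z. \<not> star_obstacle k V s (split_at s u v E) x Z")
    case True
    then show ?thesis by (intro bexI [of _ u] bexI [of _ v] conjI uv sub conn1)
  next
    case False
    then obtain t C where obst: "star_obstacle k V s (split_at s u v E) t C" by blast
    then have tV: "t \<in> V" by (auto simp: star_obstacle_def neighbors_def)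
    consider "t \<noteq> u" "t \<noteq> v" | "t = u" "u \<noteq> v" | "t = v" "v \<noteq> u" | "t = u" "u = v" by blast
    then show ?thesis
    proof cases
      case 1
      note good_split_avoiding_center [OF no_obst even uv sub conn1 obst this]
      then show ?thesis by (rule bexI [OF _ tV])
    next
      case 2
      have "star_obstacle k V s (split_at s u v E) u C" using obst 2(1) by simp
      note good_split_at_center [OF uv 2(2) even sub conn1 this]
      then show ?thesis by (rule bexI [OF bexI [OF _ uv(1)] uv(1)])
    next
      case 3
      have sub': "{# Upair s v, Upair s u #} \<subseteq># E" using sub by (simp only: add_mset_commute)
      have "connected_2k_k k V (split_at s v u E)" "star_obstacle k V s (split_at s v u E) v C"
        using obst conn1 3(1) by (simp_all only: split_at_commute [of s v u])
      note good_split_at_center [OF uv(2,1) 3(2) even sub' this]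
      then show ?thesis by (rule bexI [OF bexI [OF _ uv(2)] uv(2)])
    next
      case 4
      have "star_obstacle k V s E v C"
        using obst sub conn1 unfolding 4 by (intro obstacle_if_center_pair_split [OF uv(2) even])
      then show ?thesis using no_obst by blast
    qed
  qed
qed

end

section \<open>Complete splitting-offs by induction\<close>

lemma complete_splitting_if_no_obstacle:
  assumes "2 \<le> k" "graph_with_special V s E" "connected_2k_k k V E"
    and "sdeg s E V = 2 * n" "\<nexists>t C. star_obstacle k V s E t C"
  shows "\<exists>E'. (splitting_off V s ^^ n) E E' \<and> connected_2k_k k V E'"
  using assms(2-)
proof (induction n arbitrary: E)
  case 0
  then show ?case by auto
next
  case (Suc n)
  interpret splitting_graph k V s E using assms(1) Suc.prems by unfold_locales
  have "even (d V)" "0 < d V" using Suc.prems(3) by simp_all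
  then obtain u v where uv: "u \<in> V" "v \<in> V" and sub: "{# Upair s u, Upair s v #} \<subseteq># E"
    and conn1: "connected_2k_k k V (split_at s u v E)"
    and "\<forall>x Z. \<not> star_obstacle k V s (split_at s u v E) x Z"
    using exists_good_split [OF Suc.prems(4)] by blast
  then have no_obst: "\<nexists>t C. star_obstacle k V s (split_at s u v E) t C" by simp
  have "sdeg s (split_at s u v E) V = 2 * n"
    using sdeg_split_at [OF subset_refl s_notin_V uv sub] Suc.prems(3) uv by simp
  from Suc.IH [OF graph_with_special_split_at [OF graph uv] conn1 this no_obst]
  obtain E' where E': "(splitting_off V s ^^ n) (split_at s u v E) E'" "connected_2k_k k V E'"
    by (elim exE conjE)
  moreover have "splitting_off V s E (split_at s u v E)" using uv sub by (auto simp: splitting_off_iff)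
  ultimately show ?case using relpowp_Suc_I2 [of "splitting_off V s"] by blast
qed

text \<open>The new edge enters a bi-set only if one of its ends is inner, and then the edge between
  \<open>s\<close> and that end has been lost.\<close>

lemma f_val_split_at_le:
  assumes "biset_of V X" "s \<notin> V" "{# Upair s u, Upair s v #} \<subseteq># E"
  shows "f_val k (split_at s u v E) X \<le> f_val k E X"
  using f_val_split_at [OF assms, of k] by (auto simp: enters_Upair of_bool_def split: if_splits)

lemma f_val_splitting_offs_le:
  assumes "(splitting_off V s ^^ n) E E'" "biset_of V X" "s \<notin> V"
  shows "f_val k E' X \<le> f_val k E X"
  using assms(1)
proof (induction n arbitrary: E')
  case (Suc n)
  then obtain F where F: "(splitting_off V s ^^ n) E F" "splitting_off V s F E'" by auto
  then have "f_val k E' X \<le> f_val k F X"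
    using f_val_split_at_le [OF assms(2,3)] by (auto simp: splitting_off_iff)
  then show ?case using Suc.IH [OF F(1)] by linarith
qed simp

text \<open>
  The parity of \<open>d(s,t)\<close> can only change when \<open>st\<close> is split off with some \<open>su\<close>, \<open>u \<noteq> t\<close>, and
  this violates the member of \<open>C\<close> containing \<open>u\<close>. In the end no edge at \<open>s\<close> is left.
\<close>

lemma obstacle_prevents_complete_splitting:
  assumes "s \<notin> V" "t \<in> V" "connected_2k_k k V E'"
    and "(splitting_off V s ^^ n) E E'" "sdeg s E V = 2 * n" "odd (sdeg s E {t})"
    and "neighbors V s E - {t} \<subseteq> \<Union> (inner_set ` C)"
    and "\<And>X. X \<in> C \<Longrightarrow> proper_biset V X \<and> wall X = {t} \<and> f_val k E X \<le> 2 * k"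
  shows False
  using assms(4-)
proof (induction n arbitrary: E)
  case 0
  have "sdeg s E {t} \<le> sdeg s E V" using assms(2) by (intro sdeg_mono) auto
  then show ?case using 0 by simp
next
  case (Suc n)
  obtain E1 where E1: "splitting_off V s E E1" "(splitting_off V s ^^ n) E1 E'"
    using Suc.prems(1) relpowp_Suc_D2 by metis
  then obtain u v where uv: "u \<in> V" "v \<in> V" and sub: "{# Upair s u, Upair s v #} \<subseteq># E"
    and E1_eq: "E1 = split_at s u v E"
    by (auto simp: splitting_off_iff)
  note deg = sdeg_split_at [OF _ assms(1) uv sub, folded E1_eq]
  have C: "biset_of V X" "proper_biset V X" "wall X = {t}" "f_val k E X \<le> 2 * k"
    "t \<notin> inner_set X" "t \<in> outer_set X" if "X \<in> C" for X
    using Suc.prems(5) [OF that] by (auto simp: proper_biset_def wall_def)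
  have no_mixed: False if xy: "{x, y} = {u, v}" "x = t" "y \<noteq> t" for x y
  proof -
    have "y \<in> neighbors V s E"
      using xy uv sub unfolding pair_subset_mset_iff neighbors_iff by (auto simp: doubleton_eq_iff)
    then obtain X where X: "X \<in> C" "y \<in> inner_set X" using Suc.prems(4) xy by auto
    have "\<not> enters (Upair u v) X"
      using xy C [OF X(1)] by (auto simp: enters_Upair doubleton_eq_iff)
    moreover have "u \<in> inner_set X \<or> v \<in> inner_set X" using xy X by (auto simp: doubleton_eq_iff)
    ultimately have "f_val k E1 X < f_val k E X"
      using f_val_split_at [OF C(1) [OF X(1)] assms(1) sub, of k, folded E1_eq]
      by (auto simp: of_bool_def split: if_splits)
    \<comment> \<open>No later splitting-off raises f, so the deficit persists in
      \<open>E'\<close>.\<close>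
    then have "f_val k E' X < 2 * k"
      using f_val_splitting_offs_le [OF E1(2) C(1) [OF X(1)] assms(1), of k] C(4) [OF X(1)] by linarith
    then show False
      using assms(3) C(2) [OF X(1)] unfolding connected_2k_k_def proper_biset_def by auto
  qed
  have "u = t \<longleftrightarrow> v = t" using no_mixed [of u v] no_mixed [of v u] by auto
  then have "odd (sdeg s E1 {t})"
    using deg [of "{t}"] assms(2) Suc.prems(3) by (cases "v = t") (auto, presburger)
  moreover have "sdeg s E1 V = 2 * n" using deg [of V] uv Suc.prems(2) by simp
  moreover have "neighbors V s E1 \<subseteq> neighbors V s E"
  proof
    fix a assume "a \<in> neighbors V s E1"
    then show "a \<in> neighbors V s E" using deg [of "{a}"] by (auto simp: neighbors_iff)
  qed
  then have "neighbors V s E1 - {t} \<subseteq> \<Union> (inner_set ` C)" using Suc.prems(4) by blast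
  moreover have "proper_biset V X \<and> wall X = {t} \<and> f_val k E1 X \<le> 2 * k" if "X \<in> C" for X
    using f_val_split_at_le [OF C(1) [OF that] assms(1) sub, of k, folded E1_eq] C [OF that] by simp
  ultimately show False using Suc.IH [OF E1(2)] by blast
qed

theorem theorem6p7:
  fixes V :: "'a set" and s :: 'a and E :: "'a uprod multiset" and k :: nat
  assumes "k \<ge> 2"
    and "graph_with_special V s E"
    and "connected_2k_k k V E"
    and "degree_at V s E \<ge> 4"
    and "even (degree_at V s E)"
  shows "(\<exists>E'. complete_admissible_splitting_off k V s E E') \<longleftrightarrow>
         (\<nexists>t C. star_obstacle k V s E t C)"
proof -
  interpret splitting_graph k V s E using assms by unfold_locales
  obtain n where n: "d V = 2 * n" using assms(5) by (auto simp: degree_at_eq_sdeg elim: evenE)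
  have complete: "complete_admissible_splitting_off k V s E E' \<longleftrightarrow>
      (splitting_off V s ^^ n) E E' \<and> connected_2k_k k V E'" for E'
    by (simp add: complete_admissible_splitting_off_def complete_splitting_off_def degree_at_eq_sdeg n)
  show ?thesis
  proof
    assume "\<exists>E'. complete_admissible_splitting_off k V s E E'"
    then obtain E' where E': "(splitting_off V s ^^ n) E E'" "connected_2k_k k V E'"
      using complete by blast
    show "\<nexists>t C. star_obstacle k V s E t C"
    proof clarify
      fix t C assume obst: "star_obstacle k V s E t C"
      show False
      proof (rule obstacle_prevents_complete_splitting [OF s_notin_V _ E'(2,1) n])
        show "t \<in> V" "odd (d {t})" "N - {t} \<subseteq> \<Union> (inner_set ` C)"
          using obst N_subset by (auto simp: star_obstacle_iff)
        show "proper_biset V X \<and> wall X = {t} \<and> f X \<le> 2 * k" if "X \<in> C" for X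
          using obst that by (auto simp: star_obstacle_iff tight_at_def)
      qed
    qed
  next
    assume "\<nexists>t C. star_obstacle k V s E t C"
    then show "\<exists>E'. complete_admissible_splitting_off k V s E E'"
      using complete_splitting_if_no_obstacle [OF assms(1-3) n] complete by blast
  qed
qed

end
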